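(* For every $\alpha>0$ and every SNR $\Gamma>0$, the MP$\alpha$E exponent per unit bandwidth satisfies \[ F_{\alpha}(\Gamma)\leq\begin{cases} \gamma_{\alpha}\Gamma, & \Gamma<\frac{\alpha}{\gamma_{\alpha}},\\[2pt] \alpha\left[\log\left(\frac{\gamma_{\alpha}\Gamma}{\alpha}\right)+1\right], & \Gamma\geq\frac{\alpha}{\gamma_{\alpha}}. \end{cases} \]
   Context: Setting: a parameter $u\in[0,1)$ is to be conveyed over the continuous-time AWGN channel $y(t)=s(t,u)+z(t)$, where $z(t)$ is white Gaussian noise with two-sided spectral density $N_0/2$. A modulation–estimation system $\mathcal{S}_T$ of duration $T$ consists of a measurable modulator $u\mapsto s(\cdot,u)$ with $s(t,u)=0$ outside $[0,T]$, and an estimator mapping the received $\{y(t),0\le t\le T\}$ to an estimate $\hat u$. It is power-limited to $P$ if $\frac1T\int_0^T s^2(t,u)\,dt\le P$ for all $u$, and band-limited to $W$ if there is an orthonormal set $\{\phi_n\}_{n=1}^{N}$ of functions on $[0,T]$, $N=2WT$, such that every $s(\cdot,u)$ is a linear combination $\sum_{n=1}^N s_n(u)\phi_n(t)$. For $\alpha>0$ the mean power-$\alpha$ error (MP$\alpha$E) is $e_\alpha(\mathcal{S}_T)=\sup_{u\in[0,1)}\mathbb{E}_u|\hat u-u|^\alpha$. $E$ is an achievable MP$\alpha$E exponent if there is a family $\{\mathcal{S}_T\}$ (power-limited to $P$, band-limited to $W$) with $\limsup_{T\to\infty}[-\frac1T\log e_\alpha(\mathcal{S}_T)]\ge E$;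 $E_\alpha(P/N_0,W)$ is the largest achievable exponent. With the SNR $\Gamma=P/(N_0W)$, $E_\alpha(P/N_0,W)=W\cdot F_\alpha(\Gamma)$, and $F_\alpha(\Gamma)$ is the MP$\alpha$E exponent per unit bandwidth. The unlimited-bandwidth MP$\alpha$E exponent is $\gamma_\alpha=\lim_{\Gamma\to0}F_\alpha(\Gamma)/\Gamma$; equivalently, for systems without a bandwidth constraint the optimal MP$\alpha$E decays as $\exp(-\gamma_\alpha PT/N_0)$ to first order in the exponent. Logarithms are natural. *)

theory Defs
  imports "HOL-Probability.Probability"
begin

text \<open>
Coordinate (Karhunen-Loeve) representation of the continuous-time AWGN channel.
Fix an orthonormal basis of L2[0,T] whose first N elements span the signal space
(N \<le> 2WT). A modulator is given by the coordinate map u \<mapsto> s u, with s u n = 0 for n \<ge> N;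
the received process is represented by all its coordinates y n = s u n + z n, where the
z n are i.i.d. N(0, N0/2) (white noise of two-sided spectral density N0/2).
An estimator is a measurable map from the coordinate sequence of the received process to a real.
\<close>

definition noise :: "real \<Rightarrow> (nat \<Rightarrow> real) measure" where
  "noise N0 = PiM UNIV (\<lambda>_. density lborel (normal_density 0 (sqrt (N0 / 2))))"

definition mpae :: "real \<Rightarrow> real \<Rightarrow> (real \<Rightarrow> nat \<Rightarrow> real) \<Rightarrow> ((nat \<Rightarrow> real) \<Rightarrow> real) \<Rightarrow> ennreal" where
  "mpae \<alpha> N0 s g =
     (SUP u\<in>{0..<1}. \<integral>\<^sup>+ z. ennreal (\<bar>g (\<lambda>n. s u n + z n) - u\<bar> powr \<alpha>) \<partial>noise N0)"

definition valid_system :: "real \<Rightarrow> real \<Rightarrow> real \<Rightarrow> (real \<Rightarrow> nat \<Rightarrow> real) \<Rightarrow> ((nat \<Rightarrow> real) \<Rightarrow> real) \<Rightarrow> bool" where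
  "valid_system P W T s g \<longleftrightarrow>
     (\<exists>N::nat. real N \<le> 2 * W * T
        \<and> (\<forall>u n. N \<le> n \<longrightarrow> s u n = 0)
        \<and> (\<forall>u\<in>{0..<1}. (1 / T) * (\<Sum>n<N. (s u n)\<^sup>2) \<le> P))
     \<and> (\<forall>n. (\<lambda>u. s u n) \<in> borel_measurable borel)
     \<and> g \<in> borel_measurable (PiM UNIV (\<lambda>_. borel))"

definition err_exp :: "real \<Rightarrow> ennreal \<Rightarrow> ereal" where
  "err_exp T e = (if e = \<infinity> then -\<infinity> else if e = 0 then \<infinity> else ereal (- ln (enn2real e) / T))"

definition achievable :: "real \<Rightarrow> real \<Rightarrow> real \<Rightarrow> real \<Rightarrow> real \<Rightarrow> bool" where
  "achievable \<alpha> P N0 W E \<longleftrightarrow>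
     (\<exists>sys :: real \<Rightarrow> (real \<Rightarrow> nat \<Rightarrow> real) \<times> ((nat \<Rightarrow> real) \<Rightarrow> real).
        (\<forall>T>0. valid_system P W T (fst (sys T)) (snd (sys T)))
        \<and> ereal E \<le> Limsup at_top (\<lambda>T. err_exp T (mpae \<alpha> N0 (fst (sys T)) (snd (sys T)))))"

definition opt_exp :: "real \<Rightarrow> real \<Rightarrow> real \<Rightarrow> real \<Rightarrow> real" where
  "opt_exp \<alpha> P N0 W = Sup {E. achievable \<alpha> P N0 W E}"

text \<open>Exponent per unit bandwidth: F_alpha(Gamma) = E_alpha(P/N0, W)/W with Gamma = P/(N0 W);
  taking W = 1, N0 = 1, P = Gamma.\<close>
definition F_exp :: "real \<Rightarrow> real \<Rightarrow> real" where
  "F_exp \<alpha> \<Gamma> = opt_exp \<alpha> \<Gamma> 1 1"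

end

theory Submission
  imports Defs
begin

text \<open>
Two comparisons of exponents at SNR \<open>x \<le> \<Gamma>\<close> give the bound. Stretching time by \<open>\<Gamma> / x\<close> turns a
system for \<open>\<Gamma>\<close> into one for \<open>x\<close>, so \<open>F \<Gamma> / \<Gamma>\<close> is antitone and \<open>F x \<le> \<gamma> x\<close>. On the other hand
\<open>F \<Gamma> - \<alpha> ln \<Gamma>\<close> is antitone: with \<open>c\<^sup>2 = x / \<Gamma>\<close>, an averaging argument over spherical caps in
\<open>N \<le> 2 T\<close> dimensions finds a ball of radius \<open>c sqrt (\<Gamma> T)\<close> containing the signals of a set of
parameters of measure about \<open>c ^ N\<close>; recentring that ball and stretching the parameter set to \<open>[0, 1)\<close>
yields a system for \<open>x\<close> whose error is larger by a factor of about \<open>c powr (- 2 \<alpha> T)\<close>. The two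
inequalities combined at \<open>x = min \<Gamma> (\<alpha> / \<gamma>)\<close> are the claim. Since the exponent is a supremum of reals,
it must also be known that the achievable exponents are bounded, which is a two-point argument.
\<close>

section \<open>Caps of the sphere under Gaussian measure\<close>

abbreviation std_gauss :: "real measure" where
  "std_gauss \<equiv> density lborel (\<lambda>x. ennreal (std_normal_density x))"

lemma prob_space_std_gauss: "prob_space std_gauss"
  by (rule prob_space_normal_density) simp

text \<open>The planar Gaussian density depends on the radius alone, so a rotation may align the
  linear form with coefficients \<open>(a, b)\<close> with the second axis. The rotation is carried
  out as two one-variable affine substitutions with Fubini in between. The second slot of
  \<open>f\<close> carries the squared radius, which a cap condition needs.\<close>

lemma std_gauss_rotation:
  fixes f :: "real \<times> real \<Rightarrow> ennreal"
  assumes [measurable]: "f \<in> borel_measurable borel" and "b \<ge> 0"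
  shows "(\<integral>\<^sup>+t. \<integral>\<^sup>+y. f (a * y + b * t, y\<^sup>2 + t\<^sup>2) \<partial>std_gauss \<partial>std_gauss)
       = (\<integral>\<^sup>+t. \<integral>\<^sup>+y. f (sqrt (a\<^sup>2 + b\<^sup>2) * t, y\<^sup>2 + t\<^sup>2) \<partial>std_gauss \<partial>std_gauss)"
\<comment> \<open>The first substitution divides by \<open>a\<close>. For \<open>a = 0\<close> there
  is nothing to rotate, as \<open>b \<ge> 0\<close> gives
  \<open>sqrt (b\<^sup>2) = b\<close>.\<close>
proof (cases "a = 0")
  case True
  then show ?thesis using \<open>b \<ge> 0\<close> by simp
next
  case a: False
  define \<rho> where "\<rho> = sqrt (a\<^sup>2 + b\<^sup>2)"
  have \<rho>: "\<rho> > 0" using a by (simp add: \<rho>_def sum_power2_gt_zero_iff)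
  have \<rho>2: "\<rho>\<^sup>2 = a\<^sup>2 + b\<^sup>2" by (simp add: \<rho>_def)
  have [measurable]: "f \<in> borel_measurable (borel \<Otimes>\<^sub>M borel)"
    using assms(1) by (simp add: borel_prod)
  \<comment> \<open>The joint density is a function of the squared radius, hence it can be absorbed
    into the second argument.\<close>
  define h :: "real \<times> real \<Rightarrow> ennreal"
    where "h = (\<lambda>z. ennreal (exp (- snd z / 2) / (2 * pi)) * f z)"
  have [measurable]: "h \<in> borel_measurable (borel \<Otimes>\<^sub>M borel)"
    unfolding h_def by measurable
  have dens: "std_normal_density t * std_normal_density y = exp (- (y\<^sup>2 + t\<^sup>2) / 2) / (2 * pi)" for t y
    by (simp add: std_normal_density_def mult_exp_exp[symmetric] field_simps flip: exp_add)
  have lebesgue_form: "(\<integral>\<^sup>+t. \<integral>\<^sup>+y. f (p t y, y\<^sup>2 + t\<^sup>2) \<partial>std_gauss \<partial>std_gauss)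
      = (\<integral>\<^sup>+t. \<integral>\<^sup>+y. h (p t y, y\<^sup>2 + t\<^sup>2) \<partial>lborel \<partial>lborel)"
    if [measurable]: "case_prod p \<in> borel_measurable (borel \<Otimes>\<^sub>M borel)" for p
  proof -
    have "(\<integral>\<^sup>+t. \<integral>\<^sup>+y. f (p t y, y\<^sup>2 + t\<^sup>2) \<partial>std_gauss \<partial>std_gauss)
       = (\<integral>\<^sup>+t. ennreal (std_normal_density t) *
           (\<integral>\<^sup>+y. ennreal (std_normal_density y) * f (p t y, y\<^sup>2 + t\<^sup>2) \<partial>lborel) \<partial>lborel)"
      by (simp add: nn_integral_density)
    also have "\<dots> = (\<integral>\<^sup>+t. \<integral>\<^sup>+y. ennreal (std_normal_density t) *
         (ennreal (std_normal_density y) * f (p t y, y\<^sup>2 + t\<^sup>2)) \<partial>lborel \<partial>lborel)"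
      by (intro nn_integral_cong nn_integral_cmult[symmetric]) measurable
    also have "\<dots> = (\<integral>\<^sup>+t. \<integral>\<^sup>+y. h (p t y, y\<^sup>2 + t\<^sup>2) \<partial>lborel \<partial>lborel)"
      by (intro nn_integral_cong) (simp only: h_def mult.assoc[symmetric] dens ennreal_mult'[symmetric] normal_density_nonneg fst_conv snd_conv)
    finally show ?thesis .
  qed
  \<comment> \<open>Here \<open>p\<close> is the rotated coordinate
    \<open>(a * y + b * t) / \<rho>\<close>, and \<open>?q p t\<close> is the squared radius
    rewritten in terms of \<open>p\<close> and \<open>t\<close>.\<close>
  let ?q = "\<lambda>p t. ((\<rho> * p - b * t) / a)\<^sup>2 + t\<^sup>2"
  have "(\<integral>\<^sup>+t. \<integral>\<^sup>+y. f (a * y + b * t, y\<^sup>2 + t\<^sup>2) \<partial>std_gauss \<partial>std_gauss)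
      = (\<integral>\<^sup>+t. \<integral>\<^sup>+y. h (a * y + b * t, y\<^sup>2 + t\<^sup>2) \<partial>lborel \<partial>lborel)"
    by (rule lebesgue_form) measurable
  also have "\<dots> = (\<integral>\<^sup>+t. ennreal \<bar>\<rho> / a\<bar> * (\<integral>\<^sup>+p. h (\<rho> * p, ?q p t) \<partial>lborel) \<partial>lborel)"
  proof (rule nn_integral_cong)
    fix t :: real
    have *: "a * (- (b * t / a) + \<rho> / a * p) + b * t = \<rho> * p"
      "- (b * t / a) + \<rho> / a * p = (\<rho> * p - b * t) / a" for p
      using a by (simp_all add: field_simps)
    show "(\<integral>\<^sup>+y. h (a * y + b * t, y\<^sup>2 + t\<^sup>2) \<partial>lborel)
        = ennreal \<bar>\<rho> / a\<bar> * (\<integral>\<^sup>+p. h (\<rho> * p, ?q p t) \<partial>lborel)"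
      using a \<rho> by (subst nn_integral_real_affine[where c="\<rho> / a" and t="- (b * t / a)"])
        (simp_all only: *, simp_all)
  qed
  also have "\<dots> = (\<integral>\<^sup>+t. \<integral>\<^sup>+p. ennreal \<bar>\<rho> / a\<bar> * h (\<rho> * p, ?q p t) \<partial>lborel \<partial>lborel)"
    by (intro nn_integral_cong nn_integral_cmult[symmetric]) measurable
  also have "\<dots> = (\<integral>\<^sup>+p. \<integral>\<^sup>+t. ennreal \<bar>\<rho> / a\<bar> * h (\<rho> * p, ?q p t) \<partial>lborel \<partial>lborel)"
    by (rule lborel_pair.Fubini') measurable
  also have "\<dots> = (\<integral>\<^sup>+p. \<integral>\<^sup>+w. h (\<rho> * p, w\<^sup>2 + p\<^sup>2) \<partial>lborel \<partial>lborel)"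
  proof (rule nn_integral_cong)
    fix p :: real
    \<comment> \<open>Together the two substitutions amount to
      \<open>y = (a * p - b * w) / \<rho>\<close> and \<open>t = (b * p + a * w) / \<rho>\<close>,
      an orthogonal map. This is why the squared radius is recovered and the two Jacobian factors
      cancel.\<close>
    have *: "?q p (b * p / \<rho> + a / \<rho> * w) = w\<^sup>2 + p\<^sup>2" for w
    proof -
      have "(\<rho> * p - b * (b * p / \<rho> + a / \<rho> * w)) / a = (\<rho>\<^sup>2 * p - b\<^sup>2 * p - a * b * w) / (a * \<rho>)"
        using a \<rho> by (simp add: field_simps power2_eq_square)
      also have "\<dots> = (a * p - b * w) / \<rho>"
        unfolding \<rho>2 using a \<rho> by (simp add: field_simps power2_eq_square)
      finally have "?q p (b * p / \<rho> + a / \<rho> * w) = ((a * p - b * w) / \<rho>)\<^sup>2 + ((b * p + a * w) / \<rho>)\<^sup>2"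
        by (simp add: add_divide_distrib)
      also have "\<dots> = (a\<^sup>2 + b\<^sup>2) * (w\<^sup>2 + p\<^sup>2) / \<rho>\<^sup>2"
        by (simp add: power_divide power2_eq_square algebra_simps flip: add_divide_distrib)
      also have "\<dots> = w\<^sup>2 + p\<^sup>2"
        using \<rho> by (simp flip: \<rho>2)
      finally show ?thesis .
    qed
    have "(\<integral>\<^sup>+t. ennreal \<bar>\<rho> / a\<bar> * h (\<rho> * p, ?q p t) \<partial>lborel)
        = ennreal \<bar>a / \<rho>\<bar> * (\<integral>\<^sup>+w. ennreal \<bar>\<rho> / a\<bar> * h (\<rho> * p, w\<^sup>2 + p\<^sup>2) \<partial>lborel)"
      using a \<rho> by (subst nn_integral_real_affine[where c="a / \<rho>" and t="b * p / \<rho>"])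
        (simp_all only: *, simp_all)
    also have "\<dots> = (ennreal \<bar>a / \<rho>\<bar> * ennreal \<bar>\<rho> / a\<bar>) * (\<integral>\<^sup>+w. h (\<rho> * p, w\<^sup>2 + p\<^sup>2) \<partial>lborel)"
      by (subst nn_integral_cmult) (auto simp: mult.assoc)
    also have "ennreal \<bar>a / \<rho>\<bar> * ennreal \<bar>\<rho> / a\<bar> = 1"
      using a \<rho> by (simp flip: ennreal_mult')
    finally show "(\<integral>\<^sup>+t. ennreal \<bar>\<rho> / a\<bar> * h (\<rho> * p, ?q p t) \<partial>lborel)
        = (\<integral>\<^sup>+w. h (\<rho> * p, w\<^sup>2 + p\<^sup>2) \<partial>lborel)" by simp
  qed
  also have "\<dots> = (\<integral>\<^sup>+t. \<integral>\<^sup>+y. f (\<rho> * t, y\<^sup>2 + t\<^sup>2) \<partial>std_gauss \<partial>std_gauss)"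
    by (rule lebesgue_form[symmetric]) measurable
  finally show ?thesis by (simp add: \<rho>_def)
qed

lemma product_prob_space_std_gauss: "product_prob_space (\<lambda>_::nat. std_gauss)"
  using prob_space_std_gauss by (intro product_prob_spaceI)

text \<open>Induction that absorbs one coefficient at a time into \<open>b\<close>: the planar
  rotation in the last coordinate \<open>s\<close> and in \<open>t\<close> replaces
  \<open>x N\<close> and \<open>b\<close> by the single coefficient \<open>c\<close>, after which
  the induction hypothesis is used with \<open>s\<close> frozen and its square added to the
  radius.\<close>

lemma std_gauss_product_rotation:
  fixes f :: "real \<times> real \<Rightarrow> ennreal" and x :: "nat \<Rightarrow> real"
  assumes "f \<in> borel_measurable borel" and "b \<ge> 0"
  shows "(\<integral>\<^sup>+t. \<integral>\<^sup>+y. f ((\<Sum>i<N. x i * y i) + b * t, (\<Sum>i<N. (y i)\<^sup>2) + t\<^sup>2)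
            \<partial>PiM {..<N} (\<lambda>_. std_gauss) \<partial>std_gauss)
       = (\<integral>\<^sup>+t. \<integral>\<^sup>+y. f (sqrt ((\<Sum>i<N. (x i)\<^sup>2) + b\<^sup>2) * t, (\<Sum>i<N. (y i)\<^sup>2) + t\<^sup>2)
            \<partial>PiM {..<N} (\<lambda>_. std_gauss) \<partial>std_gauss)"
  using assms
proof (induction N arbitrary: f b)
  case 0
  interpret product_prob_space "\<lambda>_::nat. std_gauss" UNIV by (rule product_prob_space_std_gauss)
  from 0 show ?case by simp
next
  case (Suc N)
  interpret PP: product_prob_space "\<lambda>_::nat. std_gauss" UNIV by (rule product_prob_space_std_gauss)
  let ?P = "PiM {..<N} (\<lambda>_. std_gauss)"
  interpret G: prob_space std_gauss by (rule prob_space_std_gauss)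
  interpret P: prob_space ?P by (intro prob_space_PiM prob_space_std_gauss)
  interpret GP: pair_sigma_finite std_gauss ?P ..
  interpret GG: pair_sigma_finite std_gauss std_gauss ..
  note [measurable] = Suc.prems(1)
  have [measurable]: "f \<in> borel_measurable (borel \<Otimes>\<^sub>M borel)"
    using Suc.prems(1) by (simp add: borel_prod)
  have split: "(\<integral>\<^sup>+t. \<integral>\<^sup>+y. f (h y t, (\<Sum>i<Suc N. (y i)\<^sup>2) + t\<^sup>2) \<partial>PiM {..<Suc N} (\<lambda>_. std_gauss) \<partial>std_gauss)
      = (\<integral>\<^sup>+t. \<integral>\<^sup>+s. \<integral>\<^sup>+y. f (h (y(N:=s)) t, (\<Sum>i<N. (y i)\<^sup>2) + s\<^sup>2 + t\<^sup>2) \<partial>?P \<partial>std_gauss \<partial>std_gauss)"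
    if [measurable]: "case_prod h \<in> borel_measurable (PiM {..<Suc N} (\<lambda>_. std_gauss) \<Otimes>\<^sub>M borel)" for h
  proof (rule nn_integral_cong)
    fix t :: real
    have "(\<integral>\<^sup>+y. f (h y t, (\<Sum>i<Suc N. (y i)\<^sup>2) + t\<^sup>2) \<partial>PiM (insert N {..<N}) (\<lambda>_. std_gauss))
      = (\<integral>\<^sup>+s. \<integral>\<^sup>+y. f (h (y(N:=s)) t, (\<Sum>i<Suc N. ((y(N:=s)) i)\<^sup>2) + t\<^sup>2) \<partial>?P \<partial>std_gauss)"
      by (rule PP.product_nn_integral_insert_rev) (auto simp: lessThan_Suc[symmetric])
    then show "(\<integral>\<^sup>+y. f (h y t, (\<Sum>i<Suc N. (y i)\<^sup>2) + t\<^sup>2) \<partial>PiM {..<Suc N} (\<lambda>_. std_gauss))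
      = (\<integral>\<^sup>+s. \<integral>\<^sup>+y. f (h (y(N:=s)) t, (\<Sum>i<N. (y i)\<^sup>2) + s\<^sup>2 + t\<^sup>2) \<partial>?P \<partial>std_gauss)"
      by (simp add: lessThan_Suc[symmetric])
  qed
  define c where "c = sqrt ((x N)\<^sup>2 + b\<^sup>2)"
  have c: "c \<ge> 0" by (simp add: c_def)
  \<comment> \<open>The planar rotation needs the integrals over \<open>t\<close> and
    \<open>s\<close> innermost, the induction hypothesis those over \<open>t\<close> and
    \<open>y\<close>.\<close>
  have swap3: "(\<integral>\<^sup>+t. \<integral>\<^sup>+s. \<integral>\<^sup>+y. k t s y \<partial>?P \<partial>std_gauss \<partial>std_gauss)
      = (\<integral>\<^sup>+y. \<integral>\<^sup>+t. \<integral>\<^sup>+s. k t s y \<partial>std_gauss \<partial>std_gauss \<partial>?P)"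
    if [measurable]: "(\<lambda>(t, s, y). k t s y) \<in> borel_measurable (borel \<Otimes>\<^sub>M borel \<Otimes>\<^sub>M ?P)"
    for k :: "real \<Rightarrow> real \<Rightarrow> (nat \<Rightarrow> real) \<Rightarrow> ennreal"
  proof -
    define k' where "k' = (\<lambda>(t, s, y). k t s y)"
    have [measurable]: "k' \<in> borel_measurable (borel \<Otimes>\<^sub>M borel \<Otimes>\<^sub>M ?P)"
      using that by (simp add: k'_def)
    have k': "k = (\<lambda>t s y. k' (t, s, y))" by (simp add: k'_def)
    have "(\<integral>\<^sup>+t. \<integral>\<^sup>+s. \<integral>\<^sup>+y. k t s y \<partial>?P \<partial>std_gauss \<partial>std_gauss)
       = (\<integral>\<^sup>+t. \<integral>\<^sup>+y. \<integral>\<^sup>+s. k t s y \<partial>std_gauss \<partial>?P \<partial>std_gauss)"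
      unfolding k' by (intro nn_integral_cong GP.Fubini'[symmetric]) measurable
    also have "\<dots> = (\<integral>\<^sup>+y. \<integral>\<^sup>+t. \<integral>\<^sup>+s. k t s y \<partial>std_gauss \<partial>std_gauss \<partial>?P)"
      unfolding k' by (intro GP.Fubini'[symmetric]) measurable
    finally show ?thesis .
  qed
  have "(\<integral>\<^sup>+t. \<integral>\<^sup>+y. f ((\<Sum>i<Suc N. x i * y i) + b * t, (\<Sum>i<Suc N. (y i)\<^sup>2) + t\<^sup>2)
            \<partial>PiM {..<Suc N} (\<lambda>_. std_gauss) \<partial>std_gauss)
      = (\<integral>\<^sup>+t. \<integral>\<^sup>+s. \<integral>\<^sup>+y. f ((\<Sum>i<N. x i * y i) + x N * s + b * t, (\<Sum>i<N. (y i)\<^sup>2) + s\<^sup>2 + t\<^sup>2)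
            \<partial>?P \<partial>std_gauss \<partial>std_gauss)"
    by (subst split) (auto intro!: nn_integral_cong)
  also have "\<dots> = (\<integral>\<^sup>+y. \<integral>\<^sup>+t. \<integral>\<^sup>+s. f ((\<Sum>i<N. x i * y i) + x N * s + b * t, (\<Sum>i<N. (y i)\<^sup>2) + s\<^sup>2 + t\<^sup>2)
            \<partial>std_gauss \<partial>std_gauss \<partial>?P)"
    by (rule swap3) measurable
  also have "\<dots> = (\<integral>\<^sup>+y. \<integral>\<^sup>+t. \<integral>\<^sup>+s. f ((\<Sum>i<N. x i * y i) + c * t, (\<Sum>i<N. (y i)\<^sup>2) + s\<^sup>2 + t\<^sup>2)
            \<partial>std_gauss \<partial>std_gauss \<partial>?P)"
  proof (rule nn_integral_cong)
    fix y :: "nat \<Rightarrow> real"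
    show "(\<integral>\<^sup>+t. \<integral>\<^sup>+s. f ((\<Sum>i<N. x i * y i) + x N * s + b * t, (\<Sum>i<N. (y i)\<^sup>2) + s\<^sup>2 + t\<^sup>2)
            \<partial>std_gauss \<partial>std_gauss)
       = (\<integral>\<^sup>+t. \<integral>\<^sup>+s. f ((\<Sum>i<N. x i * y i) + c * t, (\<Sum>i<N. (y i)\<^sup>2) + s\<^sup>2 + t\<^sup>2)
            \<partial>std_gauss \<partial>std_gauss)"
      using std_gauss_rotation[of "\<lambda>z. f ((\<Sum>i<N. x i * y i) + fst z, (\<Sum>i<N. (y i)\<^sup>2) + snd z)" b "x N"]
        \<open>b \<ge> 0\<close> by (simp add: c_def add.assoc borel_prod[symmetric])
  qed
  also have "\<dots> = (\<integral>\<^sup>+t. \<integral>\<^sup>+s. \<integral>\<^sup>+y. f ((\<Sum>i<N. x i * y i) + c * t, (\<Sum>i<N. (y i)\<^sup>2) + s\<^sup>2 + t\<^sup>2)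
            \<partial>?P \<partial>std_gauss \<partial>std_gauss)"
    by (rule swap3[symmetric]) measurable
  also have "\<dots> = (\<integral>\<^sup>+s. \<integral>\<^sup>+t. \<integral>\<^sup>+y. f ((\<Sum>i<N. x i * y i) + c * t, (\<Sum>i<N. (y i)\<^sup>2) + s\<^sup>2 + t\<^sup>2)
            \<partial>?P \<partial>std_gauss \<partial>std_gauss)"
    by (rule GG.Fubini') measurable
  also have "\<dots> = (\<integral>\<^sup>+s. \<integral>\<^sup>+t. \<integral>\<^sup>+y. f (sqrt ((\<Sum>i<N. (x i)\<^sup>2) + c\<^sup>2) * t, (\<Sum>i<N. (y i)\<^sup>2) + s\<^sup>2 + t\<^sup>2)
            \<partial>?P \<partial>std_gauss \<partial>std_gauss)"
  proof (rule nn_integral_cong)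
    fix s :: real
    show "(\<integral>\<^sup>+t. \<integral>\<^sup>+y. f ((\<Sum>i<N. x i * y i) + c * t, (\<Sum>i<N. (y i)\<^sup>2) + s\<^sup>2 + t\<^sup>2) \<partial>?P \<partial>std_gauss)
      = (\<integral>\<^sup>+t. \<integral>\<^sup>+y. f (sqrt ((\<Sum>i<N. (x i)\<^sup>2) + c\<^sup>2) * t, (\<Sum>i<N. (y i)\<^sup>2) + s\<^sup>2 + t\<^sup>2) \<partial>?P \<partial>std_gauss)"
      using Suc.IH[of "\<lambda>z. f (fst z, snd z + s\<^sup>2)" c] c
      by (simp add: borel_prod[symmetric] add.commute add.left_commute)
  qed
  also have "\<dots> = (\<integral>\<^sup>+t. \<integral>\<^sup>+s. \<integral>\<^sup>+y. f (sqrt ((\<Sum>i<N. (x i)\<^sup>2) + c\<^sup>2) * t, (\<Sum>i<N. (y i)\<^sup>2) + s\<^sup>2 + t\<^sup>2)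
            \<partial>?P \<partial>std_gauss \<partial>std_gauss)"
    by (rule GG.Fubini') measurable
  also have "\<dots> = (\<integral>\<^sup>+t. \<integral>\<^sup>+y. f (sqrt ((\<Sum>i<N. (x i)\<^sup>2) + c\<^sup>2) * t, (\<Sum>i<Suc N. (y i)\<^sup>2) + t\<^sup>2)
            \<partial>PiM {..<Suc N} (\<lambda>_. std_gauss) \<partial>std_gauss)"
    by (subst split) auto
  also have "(\<Sum>i<N. (x i)\<^sup>2) + c\<^sup>2 = (\<Sum>i<Suc N. (x i)\<^sup>2) + b\<^sup>2"
    by (simp add: c_def)
  finally show ?case .
qed

text \<open>The tilted standard normal density is, up to the factor
  \<open>1 / sqrt (1 + \<theta>)\<close>, the normal density of variance
  \<open>1 / (1 + \<theta>)\<close>.\<close>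

lemma nn_integral_std_gauss_exp_square:
  assumes "\<theta> \<ge> 0"
  shows "(\<integral>\<^sup>+y. ennreal (exp (- \<theta> * y\<^sup>2 / 2)) \<partial>std_gauss) = ennreal (1 / sqrt (1 + \<theta>))"
proof -
  let ?\<sigma> = "1 / sqrt (1 + \<theta>)"
  have \<sigma>: "?\<sigma> > 0" using assms by simp
  have \<sigma>2: "?\<sigma>\<^sup>2 = 1 / (1 + \<theta>)" using assms by (simp add: power_divide)
  have *: "std_normal_density y * exp (- \<theta> * y\<^sup>2 / 2) = ?\<sigma> * normal_density 0 ?\<sigma> y" for y
  proof -
    have "?\<sigma> * normal_density 0 ?\<sigma> y = 1 / sqrt (2 * pi) * exp (- y\<^sup>2 * (1 + \<theta>) / 2)"
      using assms unfolding normal_density_def \<sigma>2 by (simp add: real_sqrt_mult real_sqrt_divide)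
    also have "\<dots> = std_normal_density y * exp (- \<theta> * y\<^sup>2 / 2)"
      by (simp add: std_normal_density_def field_simps flip: exp_add)
    finally show ?thesis by simp
  qed
  have "(\<integral>\<^sup>+y. ennreal (exp (- \<theta> * y\<^sup>2 / 2)) \<partial>std_gauss)
      = (\<integral>\<^sup>+y. ennreal (?\<sigma> * normal_density 0 ?\<sigma> y) \<partial>lborel)"
    by (subst nn_integral_density)
      (auto intro!: nn_integral_cong simp only: * ennreal_mult'[symmetric] normal_density_nonneg, measurable)
  also have "\<dots> = ennreal (\<integral>y. ?\<sigma> * normal_density 0 ?\<sigma> y \<partial>lborel)"
    using \<sigma> by (intro nn_integral_eq_integral integrable_mult_right integrable_normal_density) auto
  also have "\<dots> = ennreal ?\<sigma>"
    using \<sigma> by simp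
  finally show ?thesis .
qed

text \<open>The mass of the unit interval to the right of \<open>s\<close> is at least the density
  at \<open>s + 1\<close>. The cross term \<open>2 * s\<close> of \<open>(s + 1)\<^sup>2\<close> is
  traded for \<open>\<epsilon> * s\<^sup>2 + 1 / \<epsilon>\<close>, so the bound is a constant
  times a pure Gaussian in \<open>s\<close>, which later factorises over the coordinates.\<close>

lemma std_gauss_tail:
  assumes "s \<ge> 0" "\<epsilon> > 0"
  shows "emeasure std_gauss {s<..}
      \<ge> ennreal (exp (- 1 / 2 - 1 / (2 * \<epsilon>)) / sqrt (2 * pi) * exp (- (1 + \<epsilon>) * s\<^sup>2 / 2))"
proof -
  let ?B = "exp (- 1 / 2 - 1 / (2 * \<epsilon>)) / sqrt (2 * pi) * exp (- (1 + \<epsilon>) * s\<^sup>2 / 2)"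
  have "0 \<le> (\<epsilon> * s - 1)\<^sup>2 / \<epsilon>" using \<open>\<epsilon> > 0\<close> by simp
  also have "\<dots> = \<epsilon> * s\<^sup>2 - 2 * s + 1 / \<epsilon>"
    using \<open>\<epsilon> > 0\<close> by (simp add: field_simps power2_eq_square)
  finally have s: "2 * s \<le> \<epsilon> * s\<^sup>2 + 1 / \<epsilon>" by simp
  have dens: "?B \<le> std_normal_density t" if "t \<in> {s<..s+1}" for t
  proof -
    have "t\<^sup>2 \<le> (s + 1)\<^sup>2" using that \<open>s \<ge> 0\<close> by (intro power_mono) auto
    then have "- 1 / 2 - 1 / (2 * \<epsilon>) + - (1 + \<epsilon>) * s\<^sup>2 / 2 \<le> - t\<^sup>2 / 2"
      using s by (simp add: power2_eq_square field_simps)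
    then have "exp (- 1 / 2 - 1 / (2 * \<epsilon>)) * exp (- (1 + \<epsilon>) * s\<^sup>2 / 2) \<le> exp (- t\<^sup>2 / 2)"
      by (simp only: flip: exp_add) simp
    then show ?thesis
      by (simp add: std_normal_density_def divide_right_mono)
  qed
  have "ennreal ?B = (\<integral>\<^sup>+t. ennreal ?B * indicator {s<..s+1} t \<partial>lborel)"
    by (simp add: nn_integral_cmult_indicator)
  also have "\<dots> \<le> (\<integral>\<^sup>+t. ennreal (std_normal_density t) * indicator {s<..} t \<partial>lborel)"
    using dens by (intro nn_integral_mono) (auto simp: indicator_def intro!: ennreal_leI)
  also have "\<dots> = emeasure std_gauss {s<..}"
    by (simp add: emeasure_density)
  finally show ?thesis .
qed

text \<open>Rotating \<open>(x, b)\<close> onto the last axis turns the cap into \<open>t > k |y|\<close> with \<open>k\<close> the cotangent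
  of the opening angle, and \<open>exp (- k\<^sup>2 |y|\<^sup>2 / 2)\<close> integrates to \<open>(1 + k\<^sup>2) powr (- N / 2)\<close>, the
  \<open>N\<close>-th power of the sine \<open>c\<close>.\<close>
lemma gauss_cap_probability:
  fixes x :: "nat \<Rightarrow> real"
  assumes c: "0 < c" "c \<le> 1" and \<epsilon>: "\<epsilon> > 0" and "R > 0" "b \<ge> 0"
    and R: "(\<Sum>i<N. (x i)\<^sup>2) + b\<^sup>2 = R\<^sup>2"
  shows "(\<integral>\<^sup>+t. \<integral>\<^sup>+y. indicator {z. fst z > sqrt (1 - c\<^sup>2) * R * sqrt (snd z)}
            ((\<Sum>i<N. x i * y i) + b * t, (\<Sum>i<N. (y i)\<^sup>2) + t\<^sup>2)
            \<partial>PiM {..<N} (\<lambda>_. std_gauss) \<partial>std_gauss)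
      \<ge> ennreal (exp (- 1 / 2 - 1 / (2 * \<epsilon>)) / sqrt (2 * pi) * (c / sqrt (1 + \<epsilon>)) ^ N)"
proof -
  let ?P = "PiM {..<N} (\<lambda>_. std_gauss)"
  let ?C = "exp (- 1 / 2 - 1 / (2 * \<epsilon>)) / sqrt (2 * pi)"
  interpret PP: product_prob_space "\<lambda>_::nat. std_gauss" UNIV by (rule product_prob_space_std_gauss)
  interpret G: prob_space std_gauss by (rule prob_space_std_gauss)
  interpret P: prob_space ?P by (intro prob_space_PiM prob_space_std_gauss)
  interpret GP: pair_sigma_finite std_gauss ?P ..
  define \<kappa> where "\<kappa> = sqrt (1 - c\<^sup>2)"
  define k where "k = \<kappa> / c"
  define \<theta> where "\<theta> = (1 + \<epsilon>) * k\<^sup>2"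
  have c2: "c\<^sup>2 \<le> 1" using c by (simp add: power_le_one)
  have \<kappa>: "\<kappa> \<ge> 0" "\<kappa>\<^sup>2 = 1 - c\<^sup>2" using c2 by (simp_all add: \<kappa>_def)
  have k: "k \<ge> 0" "k\<^sup>2 = (1 - c\<^sup>2) / c\<^sup>2" using \<kappa> c by (simp_all add: k_def power_divide)
  have \<theta>: "\<theta> \<ge> 0" using \<epsilon> by (simp add: \<theta>_def)
  define f :: "real \<times> real \<Rightarrow> ennreal" where "f = indicator {z. fst z > \<kappa> * R * sqrt (snd z)}"
  have f_meas: "f \<in> borel_measurable borel"
    unfolding f_def borel_prod[symmetric] by measurable
  then have [measurable]: "f \<in> borel_measurable (borel \<Otimes>\<^sub>M borel)"
    by (simp add: borel_prod)
  \<comment> \<open>For fixed \<open>y\<close> of squared length \<open>S\<close>, the rotated cap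
    contains all \<open>t\<close> above \<open>k * sqrt S\<close>; the tail bound at that point is
    exponential in \<open>S\<close>.\<close>
  have inner: "ennreal (?C * exp (- \<theta> * S / 2)) \<le> (\<integral>\<^sup>+t. f (R * t, S + t\<^sup>2) \<partial>std_gauss)" if "S \<ge> 0" for S
  proof -
    have "ennreal (?C * exp (- \<theta> * S / 2)) \<le> emeasure std_gauss {k * sqrt S<..}"
    proof -
      have "- (1 + \<epsilon>) * (k * sqrt S)\<^sup>2 / 2 = - \<theta> * S / 2"
        using that by (simp add: \<theta>_def power_mult_distrib algebra_simps)
      then show ?thesis
        using std_gauss_tail[of "k * sqrt S" \<epsilon>] \<epsilon> that k(1) by (metis mult_nonneg_nonneg real_sqrt_ge_zero)
    qed
    also have "\<dots> = (\<integral>\<^sup>+t. indicator {k * sqrt S<..} t \<partial>std_gauss)" by simp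
    also have "\<dots> \<le> (\<integral>\<^sup>+t. f (R * t, S + t\<^sup>2) \<partial>std_gauss)"
    proof (rule nn_integral_mono)
      fix t
      have "R * t > \<kappa> * R * sqrt (S + t\<^sup>2)" if t: "t > k * sqrt S"
      proof -
        have "t > 0" using t k \<open>S \<ge> 0\<close> by (meson mult_nonneg_nonneg order_le_less_trans real_sqrt_ge_zero)
        have "(k * sqrt S)\<^sup>2 < t\<^sup>2" using t k \<open>S \<ge> 0\<close> by (intro power_strict_mono) auto
        then have "(1 - c\<^sup>2) * S < c\<^sup>2 * t\<^sup>2"
          using c \<open>S \<ge> 0\<close> by (simp add: power_mult_distrib k field_simps)
        then have "\<kappa>\<^sup>2 * (S + t\<^sup>2) < t\<^sup>2" by (simp add: \<kappa> algebra_simps)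
        then have "sqrt (\<kappa>\<^sup>2 * (S + t\<^sup>2)) < sqrt (t\<^sup>2)" by (rule real_sqrt_less_mono)
        then show ?thesis using \<open>t > 0\<close> \<kappa>(1) \<open>R > 0\<close> by (simp add: real_sqrt_mult mult.commute mult.left_commute)
      qed
      then show "(indicator {k * sqrt S<..} t :: ennreal) \<le> f (R * t, S + t\<^sup>2)"
        by (auto simp: f_def indicator_def)
    qed
    finally show ?thesis .
  qed
  \<comment> \<open>The right side exceeds the left by exactly \<epsilon>, because
    \<open>k\<^sup>2 = 1 / c\<^sup>2 - 1\<close>.\<close>
  have "1 + \<theta> \<le> (1 + \<epsilon>) / c\<^sup>2"
    using c \<epsilon> by (simp add: \<theta>_def k field_simps)
  then have "sqrt (1 + \<theta>) \<le> sqrt (1 + \<epsilon>) / c"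
    using c real_sqrt_le_mono by (fastforce simp: real_sqrt_divide)
  then have "c / sqrt (1 + \<epsilon>) \<le> 1 / sqrt (1 + \<theta>)"
    using c \<epsilon> \<theta> by (simp add: field_simps)
  then have "(c / sqrt (1 + \<epsilon>)) ^ N \<le> (1 / sqrt (1 + \<theta>)) ^ N"
    using c \<epsilon> by (intro power_mono) auto
  then have "ennreal (?C * (c / sqrt (1 + \<epsilon>)) ^ N) \<le> ennreal (?C * (1 / sqrt (1 + \<theta>)) ^ N)"
    by (intro ennreal_leI mult_left_mono) auto
  also have "\<dots> = ennreal ?C * (\<Prod>i<N. (\<integral>\<^sup>+y. ennreal (exp (- \<theta> * y\<^sup>2 / 2)) \<partial>std_gauss))"
    unfolding nn_integral_std_gauss_exp_square[OF \<theta>]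
    using \<theta> by (subst ennreal_mult) (auto simp: ennreal_power)
  also have "\<dots> = ennreal ?C * (\<integral>\<^sup>+y. (\<Prod>i<N. ennreal (exp (- \<theta> * (y i)\<^sup>2 / 2))) \<partial>?P)"
    by (subst PP.product_nn_integral_prod) auto
  also have "\<dots> = (\<integral>\<^sup>+y. ennreal ?C * (\<Prod>i<N. ennreal (exp (- \<theta> * (y i)\<^sup>2 / 2))) \<partial>?P)"
    by (rule nn_integral_cmult[symmetric]) measurable
  also have "\<dots> = (\<integral>\<^sup>+y. ennreal (?C * exp (- \<theta> * (\<Sum>i<N. (y i)\<^sup>2) / 2)) \<partial>?P)"
    by (intro nn_integral_cong)
      (simp add: prod_ennreal ennreal_mult'[symmetric] sum_divide_distrib sum_distrib_left sum_negf flip: exp_sum)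
  also have "\<dots> \<le> (\<integral>\<^sup>+y. \<integral>\<^sup>+t. f (R * t, (\<Sum>i<N. (y i)\<^sup>2) + t\<^sup>2) \<partial>std_gauss \<partial>?P)"
    by (intro nn_integral_mono inner sum_nonneg) auto
  also have "\<dots> = (\<integral>\<^sup>+t. \<integral>\<^sup>+y. f (R * t, (\<Sum>i<N. (y i)\<^sup>2) + t\<^sup>2) \<partial>?P \<partial>std_gauss)"
    by (rule GP.Fubini') measurable
  also have "\<dots> = (\<integral>\<^sup>+t. \<integral>\<^sup>+y. f ((\<Sum>i<N. x i * y i) + b * t, (\<Sum>i<N. (y i)\<^sup>2) + t\<^sup>2) \<partial>?P \<partial>std_gauss)"
    using std_gauss_product_rotation[OF f_meas \<open>b \<ge> 0\<close>, of N x] R \<open>R > 0\<close> by simp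
  finally show ?thesis by (simp add: f_def \<kappa>_def)
qed

text \<open>The curve is lifted to the sphere of radius \<open>R\<close> by one extra coordinate \<open>b\<close>; a random cap of
  angular sine \<open>c\<close> lies in a ball of radius \<open>c R\<close>, so some cap catches an average share of the curve.\<close>
lemma dense_ball_on_curve:
  fixes x :: "real \<Rightarrow> nat \<Rightarrow> real"
  assumes x_meas: "\<And>i. (\<lambda>u. x u i) \<in> borel_measurable borel"
    and x_bound: "\<And>u. u \<in> {0..<1} \<Longrightarrow> (\<Sum>i<N. (x u i)\<^sup>2) \<le> R\<^sup>2"
    and R: "R > 0" and c: "0 < c" "c \<le> 1" and \<epsilon>: "\<epsilon> > 0"
  obtains U w where "U \<in> sets borel" "U \<subseteq> {0..<1}"
    "measure lborel U \<ge> exp (- 1 / 2 - 1 / (2 * \<epsilon>)) / sqrt (2 * pi) * (c / sqrt (1 + \<epsilon>)) ^ N / 2"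
    "\<And>u. u \<in> U \<Longrightarrow> (\<Sum>i<N. (x u i - w i)\<^sup>2) \<le> (c * R)\<^sup>2"
proof -
  let ?P = "PiM {..<N} (\<lambda>_. std_gauss)"
  interpret G: prob_space std_gauss by (rule prob_space_std_gauss)
  interpret P: prob_space ?P by (intro prob_space_PiM prob_space_std_gauss)
  interpret GP: pair_sigma_finite std_gauss ?P ..
  interpret LP: pair_sigma_finite lborel ?P ..
  interpret LG: pair_sigma_finite lborel std_gauss ..
  define \<kappa> where "\<kappa> = sqrt (1 - c\<^sup>2)"
  have c2: "c\<^sup>2 \<le> 1" using c by (simp add: power_le_one)
  have \<kappa>: "\<kappa> \<ge> 0" "\<kappa>\<^sup>2 = 1 - c\<^sup>2" using c2 by (simp_all add: \<kappa>_def)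
  define b where "b u = sqrt (R\<^sup>2 - (\<Sum>i<N. (x u i)\<^sup>2))" for u
  note [measurable] = x_meas
  have [measurable]: "b \<in> borel_measurable borel"
    unfolding b_def by measurable
  have b: "b u \<ge> 0" "(\<Sum>i<N. (x u i)\<^sup>2) + (b u)\<^sup>2 = R\<^sup>2" if "u \<in> {0..<1}" for u
    using x_bound[OF that] by (auto simp: b_def)
  define B where "B = exp (- 1 / 2 - 1 / (2 * \<epsilon>)) / sqrt (2 * pi) * (c / sqrt (1 + \<epsilon>)) ^ N"
  have B: "B > 0" using c \<epsilon> by (simp add: B_def)
  define f :: "real \<times> real \<Rightarrow> ennreal" where "f = indicator {z. fst z > \<kappa> * R * sqrt (snd z)}"
  have [measurable]: "f \<in> borel_measurable (borel \<Otimes>\<^sub>M borel)"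
    unfolding f_def by measurable
  define h where "h t y u = f ((\<Sum>i<N. x u i * y i) + b u * t, (\<Sum>i<N. (y i)\<^sup>2) + t\<^sup>2) * indicator {0..<1} u"
    for t y u
  define U where "U t y = {u \<in> {0..<1}. (\<Sum>i<N. x u i * y i) + b u * t > \<kappa> * R * sqrt ((\<Sum>i<N. (y i)\<^sup>2) + t\<^sup>2)}"
    for t and y :: "nat \<Rightarrow> real"
  have U_sets [measurable]: "U t y \<in> sets borel" for t y
    unfolding U_def by measurable
  have U_sub: "U t y \<subseteq> {0..<1}" for t y by (auto simp: U_def)
  have h_int: "(\<integral>\<^sup>+u. h t y u \<partial>lborel) = emeasure lborel (U t y)" for t y
  proof -
    have "h t y u = indicator (U t y) u" for u
      by (auto simp: h_def f_def U_def indicator_def)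
    then show ?thesis by simp
  qed
  have "ennreal B = (\<integral>\<^sup>+u. ennreal B * indicator {0..<1::real} u \<partial>lborel)"
    by (simp add: nn_integral_cmult_indicator)
  \<comment> \<open>All lifted points have the same length \<open>R\<close>, so the cap bound
    \<open>B\<close> is uniform in \<open>u\<close>. Exchanging the integrals then averages the
    measure of \<open>U t y\<close> over the random direction.\<close>
  also have "\<dots> \<le> (\<integral>\<^sup>+u. \<integral>\<^sup>+t. \<integral>\<^sup>+y. h t y u \<partial>?P \<partial>std_gauss \<partial>lborel)"
  proof (rule nn_integral_mono)
    fix u :: real
    show "ennreal B * indicator {0..<1} u \<le> (\<integral>\<^sup>+t. \<integral>\<^sup>+y. h t y u \<partial>?P \<partial>std_gauss)"
    proof (cases "u \<in> {0..<1}")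
      case True
      then show ?thesis
        using gauss_cap_probability[OF c \<epsilon> R b[OF True]]
        by (simp add: h_def f_def B_def \<kappa>_def)
    qed simp
  qed
  also have "\<dots> = (\<integral>\<^sup>+t. \<integral>\<^sup>+u. \<integral>\<^sup>+y. h t y u \<partial>?P \<partial>lborel \<partial>std_gauss)"
    unfolding h_def by (rule LG.Fubini'[symmetric]) measurable
  also have "\<dots> = (\<integral>\<^sup>+t. \<integral>\<^sup>+y. \<integral>\<^sup>+u. h t y u \<partial>lborel \<partial>?P \<partial>std_gauss)"
    unfolding h_def by (intro nn_integral_cong LP.Fubini'[symmetric]) measurable
  also have "\<dots> = (\<integral>\<^sup>+t. \<integral>\<^sup>+y. emeasure lborel (U t y) \<partial>?P \<partial>std_gauss)"
    by (simp add: h_int)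
  finally have avg: "ennreal B \<le> (\<integral>\<^sup>+t. \<integral>\<^sup>+y. emeasure lborel (U t y) \<partial>?P \<partial>std_gauss)" .
  \<comment> \<open>Both Gaussian measures have total mass 1, so if every \<open>U t y\<close> had
    measure below \<open>B / 2\<close>, the average could not reach \<open>B\<close>.\<close>
  have "\<exists>t y. emeasure lborel (U t y) \<ge> ennreal (B / 2)"
  proof (rule ccontr)
    assume "\<not> ?thesis"
    then have "(\<integral>\<^sup>+t. \<integral>\<^sup>+y. emeasure lborel (U t y) \<partial>?P \<partial>std_gauss)
        \<le> (\<integral>\<^sup>+t. \<integral>\<^sup>+y. ennreal (B / 2) \<partial>?P \<partial>std_gauss)"
      by (intro nn_integral_mono) (metis linear)
    also have "\<dots> = ennreal (B / 2)"
      using P.emeasure_space_1 G.emeasure_space_1 by simp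
    finally have "ennreal B \<le> ennreal (B / 2)" using avg by (rule order_trans[rotated])
    then show False using B by simp
  qed
  then obtain t y where ty: "emeasure lborel (U t y) \<ge> ennreal (B / 2)" by blast
  have "emeasure lborel (U t y) \<le> emeasure lborel {0..<1::real}"
    by (rule emeasure_mono[OF U_sub]) simp
  then have "emeasure lborel (U t y) \<noteq> \<infinity>" by (auto simp: top_unique)
  then have meas: "measure lborel (U t y) \<ge> B / 2"
    using ty by (simp add: emeasure_eq_ennreal_measure measure_nonneg ennreal_le_iff)
  define q where "q = (\<Sum>i<N. (y i)\<^sup>2) + t\<^sup>2"
  \<comment> \<open>The direction \<open>(y, t)\<close> is scaled to length
    \<open>\<kappa> * R\<close>, which gives the centre of the flat base of the cap. The base has
    radius \<open>c * R\<close>, since \<open>\<kappa>\<^sup>2 + c\<^sup>2 = 1\<close>.\<close>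
  define m where "m = \<kappa> * R / sqrt q"
  show thesis
  proof (rule that[of "U t y" "\<lambda>i. m * y i"])
    fix u assume u: "u \<in> U t y"
    then have u01: "u \<in> {0..<1}" using U_sub by blast
    define p where "p = (\<Sum>i<N. x u i * y i) + b u * t"
    have p: "p > \<kappa> * R * sqrt q" using u by (simp add: U_def p_def q_def)
    have "q \<ge> 0" by (auto simp: q_def intro!: sum_nonneg add_nonneg_nonneg)
    \<comment> \<open>The strict inequality in \<open>U\<close> excludes the zero direction, for
      which \<open>m\<close> would be a division by zero.\<close>
    have "q \<noteq> 0"
    proof
      assume "q = 0"
      then have "(\<Sum>i<N. (y i)\<^sup>2) = 0" "t = 0"
        by (auto simp: q_def add_nonneg_eq_0_iff sum_nonneg)
      then have "p = 0" by (simp add: p_def sum_nonneg_eq_0_iff)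
      with p \<open>q = 0\<close> show False by simp
    qed
    with \<open>q \<ge> 0\<close> have q: "q > 0" by simp
    have m: "m \<ge> 0" using \<kappa> R q by (simp add: m_def)
    have "m * (\<kappa> * R * sqrt q) \<le> m * p" using m p by (intro mult_left_mono) auto
    then have mp: "\<kappa>\<^sup>2 * R\<^sup>2 \<le> m * p" using q by (simp add: m_def power2_eq_square algebra_simps)
    have mq: "m\<^sup>2 * q = \<kappa>\<^sup>2 * R\<^sup>2" using q by (simp add: m_def power_divide power_mult_distrib)
    \<comment> \<open>Dropping the lifted coordinate only decreases the distance to the
      centre.\<close>
    have "(\<Sum>i<N. (x u i - m * y i)\<^sup>2) \<le> (\<Sum>i<N. (x u i - m * y i)\<^sup>2) + (b u - m * t)\<^sup>2" by simp
    also have "\<dots> = ((\<Sum>i<N. (x u i)\<^sup>2) + (b u)\<^sup>2) - 2 * m * p + m\<^sup>2 * q"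
      by (simp add: p_def q_def power2_diff sum.distrib sum_subtractf sum_distrib_left algebra_simps power_mult_distrib)
    also have "\<dots> = R\<^sup>2 - 2 * (m * p) + \<kappa>\<^sup>2 * R\<^sup>2" using b[OF u01] mq by simp
    also have "\<dots> \<le> R\<^sup>2 - \<kappa>\<^sup>2 * R\<^sup>2" using mp by linarith
    also have "\<dots> = (c * R)\<^sup>2" by (simp add: \<kappa> algebra_simps power_mult_distrib)
    finally show "(\<Sum>i<N. (x u i - m * y i)\<^sup>2) \<le> (c * R)\<^sup>2" .
  qed (use U_sub meas in \<open>auto simp: B_def\<close>)
qed

section \<open>Restricting a system to a ball of signals\<close>

text \<open>Closedness of \<open>K\<close> forces the generalised inverse \<open>\<phi>\<close> of its normalised distribution function
  \<open>H\<close> to take values in \<open>K\<close> everywhere, not just almost everywhere.\<close>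
lemma closed_set_reparametrisation:
  fixes K :: "real set"
  assumes K: "closed K" "K \<subseteq> {0..<1}" and m: "measure lborel K = m" "m > 0"
  obtains \<phi> H :: "real \<Rightarrow> real" where
    "mono \<phi>" "mono H"
    "\<And>v. v \<in> {0..<1} \<Longrightarrow> \<phi> v \<in> K \<and> H (\<phi> v) = v"
    "\<And>u u'. \<bar>H u - H u'\<bar> \<le> \<bar>u - u'\<bar> / m"
proof -
  have K_sets [measurable]: "K \<in> sets borel" using K by (simp add: borel_closed)
  have fin: "emeasure lborel K < \<infinity>"
  proof -
    have "emeasure lborel K \<le> emeasure lborel {0..<1::real}" using K by (intro emeasure_mono) auto
    then show ?thesis by (simp add: order_le_less_trans)
  qed
  then have fm: "K \<inter> A \<in> fmeasurable lborel" if "A \<in> sets borel" for A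
    using that by (intro fmeasurable_Int_fmeasurable fmeasurableI) auto
  define H where "H u = measure lborel (K \<inter> {..u}) / m" for u
  have split: "H u' - H u = measure lborel (K \<inter> {u<..u'}) / m" if "u \<le> u'" for u u'
  proof -
    have "K \<inter> {..u'} = (K \<inter> {..u}) \<union> (K \<inter> {u<..u'})" using that by auto
    then have "measure lborel (K \<inter> {..u'}) = measure lborel (K \<inter> {..u}) + measure lborel (K \<inter> {u<..u'})"
      using fm by (simp only:) (rule measure_Union, auto simp: fmeasurable_def less_top[symmetric])
    then show ?thesis by (simp add: H_def add_divide_distrib)
  qed
  have monoH: "mono H"
  proof (rule monoI)
    fix u u' :: real assume "u \<le> u'"
    from split[OF this] m show "H u \<le> H u'" by (smt (verit) divide_nonneg_pos measure_nonneg)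
  qed
  have step: "H u' - H u \<le> (u' - u) / m" if "u \<le> u'" for u u'
  proof -
    have "measure lborel (K \<inter> {u<..u'}) \<le> measure lborel {u<..u'}"
      using that by (intro measure_mono_fmeasurable) (auto simp: fmeasurable_def)
    then show ?thesis using split[OF that] that m by (simp add: divide_right_mono)
  qed
  have lip: "\<bar>H u - H u'\<bar> \<le> \<bar>u - u'\<bar> / m" for u u'
  proof (cases "u \<le> u'")
    case True
    then show ?thesis using step[of u u'] monoD[OF monoH, of u u'] by simp
  next
    case False
    then show ?thesis using step[of u' u] monoD[OF monoH, of u' u] by simp
  qed
  have cont: "continuous_on UNIV H"
    by (rule lipschitz_on_continuous_on[where L="1 / m"], rule lipschitz_onI)
       (use lip m in \<open>auto simp: dist_real_def\<close>)
  have H0: "H u = 0" if "u < 0" for u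
  proof -
    have "K \<inter> {..u} = {}" using that K by fastforce
    then show ?thesis by (simp add: H_def)
  qed
  have H1: "H u = 1" if "u \<ge> 1" for u
  proof -
    have "K \<inter> {..u} = K" using that K by fastforce
    then show ?thesis using m by (simp add: H_def)
  qed
  \<comment> \<open>The cut at 1 keeps \<open>S v\<close> bounded above, and \<open>max v 0\<close>
    keeps -1 in it, so the supremum is meaningful and monotone for every real
    \<open>v\<close>.\<close>
  define S where "S v = {u. u \<le> 1 \<and> H u \<le> max v 0}" for v
  define \<phi> where "\<phi> v = Sup (S v)" for v
  have S_ne: "-1 \<in> S v" for v by (simp add: S_def H0)
  have S_bdd: "bdd_above (S v)" for v by (auto simp: S_def intro!: bdd_aboveI)
  have mono_phi: "mono \<phi>"
    unfolding \<phi>_def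
  proof (intro monoI cSup_subset_mono S_bdd)
    fix v v' :: real assume "v \<le> v'"
    show "S v \<noteq> {}" using S_ne by blast
    show "S v \<subseteq> S v'" using \<open>v \<le> v'\<close> by (auto simp: S_def)
  qed
  have good: "\<phi> v \<in> K \<and> H (\<phi> v) = v" if v: "v \<in> {0..<1}" for v
  proof -
    have "closed (S v)"
    proof -
      have "closed {u. H u \<le> max v 0}"
        using cont by (intro closed_Collect_le continuous_intros)
      then have "closed ({..1} \<inter> {u. H u \<le> max v 0})" by (intro closed_Int) auto
      moreover have "S v = {..1} \<inter> {u. H u \<le> max v 0}" by (auto simp: S_def)
      ultimately show ?thesis by simp
    qed
    then have in_S: "\<phi> v \<in> S v"
      unfolding \<phi>_def using S_ne S_bdd by (intro closed_contains_Sup) auto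
    then have le: "H (\<phi> v) \<le> v" using v by (simp add: S_def)
    have above: "H u > v" if "u > \<phi> v" for u
    proof (rule ccontr)
      assume "\<not> H u > v"
      then have "u \<in> S v" using v H1[of u] by (cases "u \<le> 1") (auto simp: S_def)
      then have "u \<le> \<phi> v" unfolding \<phi>_def by (intro cSup_upper S_bdd)
      with that show False by simp
    qed
    have "H (\<phi> v) = v"
    proof (rule ccontr)
      assume "H (\<phi> v) \<noteq> v"
      with le have d: "v - H (\<phi> v) > 0" by simp
      \<comment> \<open>By the Lipschitz bound \<open>H\<close> can rise by at most the missing
        amount \<open>v - H (\<phi> v)\<close> up to this point, so \<open>H u \<le> v\<close>
        although \<open>u\<close> lies beyond the supremum.\<close>
      define u where "u = \<phi> v + m * (v - H (\<phi> v))"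
      have "u > \<phi> v" using d m by (simp add: u_def)
      from above[OF this] step[of "\<phi> v" u] \<open>u > \<phi> v\<close> m show False by (simp add: u_def)
    qed
    moreover have "\<phi> v \<in> K"
    proof (rule ccontr)
      assume "\<phi> v \<notin> K"
      then have "open (- K)" "\<phi> v \<in> - K" using K by auto
      then obtain e where e: "e > 0" "ball (\<phi> v) e \<subseteq> - K" by (meson open_contains_ball)
      \<comment> \<open>\<open>H\<close> is constant across a gap of \<open>K\<close>, whereas it
        must exceed \<open>v\<close> immediately to the right of \<open>\<phi> v\<close>.\<close>
      have "K \<inter> {\<phi> v<..\<phi> v + e / 2} = {}"
      proof (rule ccontr)
        assume "K \<inter> {\<phi> v<..\<phi> v + e / 2} \<noteq> {}"
        then obtain z where "z \<in> K" "\<phi> v < z" "z \<le> \<phi> v + e / 2" by auto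
        moreover then have "z \<in> ball (\<phi> v) e" using e by (simp add: dist_real_def)
        ultimately show False using e by auto
      qed
      then have "H (\<phi> v + e / 2) = H (\<phi> v)"
        using split[of "\<phi> v" "\<phi> v + e / 2"] e by simp
      with above[of "\<phi> v + e / 2"] e le show False by simp
    qed
    ultimately show ?thesis by simp
  qed
  show thesis by (rule that[OF mono_phi monoH good lip])
qed

text \<open>The new modulator sends \<open>v\<close> through \<open>\<phi>\<close> into a closed set
  \<open>K\<close> of parameters whose signals lie in a ball of radius \<open>c * R\<close>, and
  subtracts the centre of that ball. The new estimator adds the centre back and applies
  \<open>H\<close>. As \<open>H\<close> inverts \<open>\<phi>\<close> and is Lipschitz with constant
  \<open>1 / m\<close>, each realisation of the noise has its error multiplied by at most
  \<open>1 / m\<close>.\<close>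

lemma shrink_system:
  assumes sys: "valid_system \<Gamma> 1 T s g"
    and pos: "\<alpha> > 0" "\<Gamma> > 0" "T > 0" and c: "0 < c" "c \<le> 1" and \<epsilon>: "\<epsilon> > 0"
  obtains s' g' where "valid_system (c\<^sup>2 * \<Gamma>) 1 T s' g'"
    "mpae \<alpha> N0 s' g' \<le> ennreal
       ((4 * sqrt (2 * pi) * exp (1 / 2 + 1 / (2 * \<epsilon>)) * (sqrt (1 + \<epsilon>) / c) powr (2 * T)) powr \<alpha>)
       * mpae \<alpha> N0 s g"
proof -
  from sys obtain N where N: "real N \<le> 2 * T" "\<And>u n. N \<le> n \<Longrightarrow> s u n = 0"
      "\<And>u. u \<in> {0..<1} \<Longrightarrow> 1 / T * (\<Sum>n<N. (s u n)\<^sup>2) \<le> \<Gamma>"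
    and s_meas: "\<And>n. (\<lambda>u. s u n) \<in> borel_measurable borel"
    and g_meas: "g \<in> borel_measurable (PiM UNIV (\<lambda>_. borel))"
    by (auto simp: valid_system_def)
  define R where "R = sqrt (\<Gamma> * T)"
  have R: "R > 0" "R\<^sup>2 = \<Gamma> * T" using pos by (simp_all add: R_def)
  have s_bound: "(\<Sum>n<N. (s u n)\<^sup>2) \<le> R\<^sup>2" if "u \<in> {0..<1}" for u
    using N(3)[OF that] pos by (simp add: R field_simps)
  define B where "B = exp (- 1 / 2 - 1 / (2 * \<epsilon>)) / sqrt (2 * pi) * (c / sqrt (1 + \<epsilon>)) ^ N / 2"
  have B: "B > 0" using c \<epsilon> by (simp add: B_def)
  obtain U w where U: "U \<in> sets borel" "U \<subseteq> {0..<1}" "measure lborel U \<ge> B"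
    "\<And>u. u \<in> U \<Longrightarrow> (\<Sum>i<N. (s u i - w i)\<^sup>2) \<le> (c * R)\<^sup>2"
    by (rule dense_ball_on_curve[OF s_meas s_bound R(1) c \<epsilon>, folded B_def]) (assumption, rule that, assumption+)
  \<comment> \<open>Half of the measure is given up for closedness: the error is a supremum over all
    parameters, so \<open>\<phi>\<close> must never leave the good set, not even on a null
    set.\<close>
  obtain K where K: "closed K" "K \<subseteq> U" "U - K \<in> lmeasurable" "emeasure lebesgue (U - K) < ennreal (B / 2)"
    using sets_lebesgue_inner_closed[of U "B / 2"] U B by auto
  have K01: "K \<subseteq> {0..<1}" using K U by blast
  define m where "m = measure lborel K"
  have m: "m \<ge> B / 2"
  proof -
    have fm: "K \<in> lmeasurable"
      using K K01 by (intro bounded_set_imp_lmeasurable) (auto intro: bounded_subset[of "{0..<1}"])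
    have "measure lebesgue U = measure lebesgue K + measure lebesgue (U - K)"
      using measure_Un2[OF fm K(3)] K(2) by (simp add: Un_absorb1)
    moreover have "measure lebesgue (U - K) \<le> B / 2"
      using K(3,4) B by (simp add: emeasure_eq_measure2 ennreal_less_iff)
    ultimately show ?thesis using U(1,3) K(1) by (simp add: m_def borel_closed)
  qed
  with B have "m > 0" by simp
  obtain \<phi> H :: "real \<Rightarrow> real" where \<phi>H: "mono \<phi>" "mono H"
      "\<And>v. v \<in> {0..<1} \<Longrightarrow> \<phi> v \<in> K \<and> H (\<phi> v) = v"
      "\<And>u u'. \<bar>H u - H u'\<bar> \<le> \<bar>u - u'\<bar> / m"
    by (rule closed_set_reparametrisation[OF K(1) K01 m_def[symmetric] \<open>m > 0\<close>]) (rule that, assumption+)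
  note [measurable] = borel_measurable_mono[OF \<phi>H(1)] borel_measurable_mono[OF \<phi>H(2)] s_meas g_meas
  \<comment> \<open>The centre is cut off at \<open>N\<close>, since the recentred signals must
    still vanish in all later coordinates.\<close>
  define w' where "w' n = (if n < N then w n else 0)" for n
  define s' where "s' v n = s (\<phi> v) n - w' n" for v n
  define g' where "g' y = H (g (\<lambda>n. y n + w' n))" for y
  have "valid_system (c\<^sup>2 * \<Gamma>) 1 T s' g'"
    unfolding valid_system_def
  proof (intro conjI exI[of _ N] allI ballI impI)
    show "real N \<le> 2 * 1 * T" using N by simp
    show "s' u n = 0" if "N \<le> n" for u n using that N(2) by (simp add: s'_def w'_def)
    show "1 / T * (\<Sum>n<N. (s' u n)\<^sup>2) \<le> c\<^sup>2 * \<Gamma>" if "u \<in> {0..<1}" for u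
    proof -
      have "\<phi> u \<in> U" using \<phi>H(3)[OF that] K by blast
      from U(4)[OF this] have "(\<Sum>n<N. (s' u n)\<^sup>2) \<le> c\<^sup>2 * (\<Gamma> * T)"
        by (simp add: s'_def w'_def power_mult_distrib R)
      then show ?thesis using pos by (simp add: field_simps)
    qed
    show "(\<lambda>u. s' u n) \<in> borel_measurable borel" for n unfolding s'_def by measurable
    have "(\<lambda>y n. y n + w' n) \<in> measurable (PiM UNIV (\<lambda>_. borel)) (PiM UNIV (\<lambda>_. borel))"
      by (rule measurable_PiM_single') auto
    from measurable_compose[OF this g_meas]
    show "g' \<in> borel_measurable (PiM UNIV (\<lambda>_. borel))"
      unfolding g'_def by measurable
  qed
  moreover have "mpae \<alpha> N0 s' g' \<le> ennreal
       ((4 * sqrt (2 * pi) * exp (1 / 2 + 1 / (2 * \<epsilon>)) * (sqrt (1 + \<epsilon>) / c) powr (2 * T)) powr \<alpha>)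
       * mpae \<alpha> N0 s g"
  proof -
    let ?D = "4 * sqrt (2 * pi) * exp (1 / 2 + 1 / (2 * \<epsilon>)) * (sqrt (1 + \<epsilon>) / c) powr (2 * T)"
    \<comment> \<open>A base of at least 1 allows the exponent \<open>N\<close> to be raised to
      \<open>2 * T\<close>, which removes the dependence on the actual dimension.\<close>
    have "1 \<le> sqrt (1 + \<epsilon>) / c" using c \<epsilon> by (simp add: field_simps) (smt (verit) real_sqrt_ge_1_iff)
    then have "(sqrt (1 + \<epsilon>) / c) ^ N \<le> (sqrt (1 + \<epsilon>) / c) powr (2 * T)"
      using N(1) by (subst powr_realpow[symmetric]) (auto intro: powr_mono)
    then have "4 * sqrt (2 * pi) * exp (1 / 2 + 1 / (2 * \<epsilon>)) * (sqrt (1 + \<epsilon>) / c) ^ N \<le> ?D"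
      by (intro mult_left_mono) auto
    \<comment> \<open>The 4 collects two factors 2: one from the averaging over caps, one from the
      passage to a closed subset.\<close>
    moreover have "1 / (B / 2) = 4 * sqrt (2 * pi) * exp (1 / 2 + 1 / (2 * \<epsilon>)) * (sqrt (1 + \<epsilon>) / c) ^ N"
    proof -
      have "exp (- 1 / 2 - 1 / (2 * \<epsilon>)) = inverse (exp (1 / 2 + 1 / (2 * \<epsilon>)))"
        by (simp flip: exp_minus)
      then show ?thesis using c \<epsilon> by (simp add: B_def power_divide field_simps)
    qed
    moreover have "1 / m \<le> 1 / (B / 2)" using m B by (intro divide_left_mono) auto
    ultimately have D: "1 / m \<le> ?D" by linarith
    have "(\<integral>\<^sup>+ z. ennreal (\<bar>g' (\<lambda>n. s' v n + z n) - v\<bar> powr \<alpha>) \<partial>noise N0)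
        \<le> ennreal (?D powr \<alpha>) * mpae \<alpha> N0 s g" if v: "v \<in> {0..<1}" for v
    proof -
      have \<phi>: "\<phi> v \<in> {0..<1}" "H (\<phi> v) = v" using \<phi>H(3)[OF v] K01 by auto
      have "(\<integral>\<^sup>+ z. ennreal (\<bar>g' (\<lambda>n. s' v n + z n) - v\<bar> powr \<alpha>) \<partial>noise N0)
        \<le> (\<integral>\<^sup>+ z. ennreal (?D powr \<alpha>) * ennreal (\<bar>g (\<lambda>n. s (\<phi> v) n + z n) - \<phi> v\<bar> powr \<alpha>) \<partial>noise N0)"
      proof (rule nn_integral_mono)
        fix z
        define a where "a = g (\<lambda>n. s (\<phi> v) n + z n)"
        have "g' (\<lambda>n. s' v n + z n) = H a" by (simp add: g'_def s'_def a_def)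
        moreover have "\<bar>H a - v\<bar> \<le> ?D * \<bar>a - \<phi> v\<bar>"
        proof -
          have "\<bar>H a - v\<bar> \<le> 1 / m * \<bar>a - \<phi> v\<bar>" using \<phi>H(4)[of a "\<phi> v"] \<phi> by simp
          also have "\<dots> \<le> ?D * \<bar>a - \<phi> v\<bar>" using D by (rule mult_right_mono) simp
          finally show ?thesis .
        qed
        then have "\<bar>H a - v\<bar> powr \<alpha> \<le> (?D * \<bar>a - \<phi> v\<bar>) powr \<alpha>" using pos by (intro powr_mono2) auto
        moreover have "(?D * \<bar>a - \<phi> v\<bar>) powr \<alpha> = ?D powr \<alpha> * \<bar>a - \<phi> v\<bar> powr \<alpha>"
          by (rule powr_mult)
        ultimately show "ennreal (\<bar>g' (\<lambda>n. s' v n + z n) - v\<bar> powr \<alpha>)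
            \<le> ennreal (?D powr \<alpha>) * ennreal (\<bar>g (\<lambda>n. s (\<phi> v) n + z n) - \<phi> v\<bar> powr \<alpha>)"
          by (simp add: a_def ennreal_mult'[symmetric] ennreal_leI)
      qed
      also have "\<dots> = ennreal (?D powr \<alpha>) * (\<integral>\<^sup>+ z. ennreal (\<bar>g (\<lambda>n. s (\<phi> v) n + z n) - \<phi> v\<bar> powr \<alpha>) \<partial>noise N0)"
      proof (rule nn_integral_cmult)
        have "(\<lambda>z n. s (\<phi> v) n + z n) \<in> measurable (noise N0) (PiM UNIV (\<lambda>_. borel))"
          unfolding noise_def by (rule measurable_PiM_single') auto
        from measurable_compose[OF this g_meas]
        show "(\<lambda>z. ennreal (\<bar>g (\<lambda>n. s (\<phi> v) n + z n) - \<phi> v\<bar> powr \<alpha>)) \<in> borel_measurable (noise N0)"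
          by measurable
      qed
      also have "\<dots> \<le> ennreal (?D powr \<alpha>) * mpae \<alpha> N0 s g"
        unfolding mpae_def by (intro mult_left_mono SUP_upper \<phi>) auto
      finally show ?thesis .
    qed
    then show ?thesis
      unfolding mpae_def[of \<alpha> N0 s' g'] by (intro SUP_least)
  qed
  ultimately show thesis by (rule that)
qed

section \<open>Lower bound on the error\<close>

lemma (in product_prob_space) nn_integral_PiM_prod:
  assumes "finite J" "J \<subseteq> I" and f: "\<And>i. i \<in> J \<Longrightarrow> f i \<in> borel_measurable (M i)"
  shows "(\<integral>\<^sup>+z. (\<Prod>i\<in>J. f i (z i)) \<partial>PiM I M) = (\<Prod>i\<in>J. \<integral>\<^sup>+t. f i t \<partial>M i)"
proof -
  have [measurable]: "(\<lambda>z. \<Prod>i\<in>J. f i (z i)) \<in> borel_measurable (PiM J M)"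
    using f by (intro borel_measurable_prod_ennreal)
      (auto intro!: measurable_compose[OF measurable_component_singleton])
  have "(\<Prod>i\<in>J. \<integral>\<^sup>+t. f i t \<partial>M i) = (\<integral>\<^sup>+z. (\<Prod>i\<in>J. f i (z i)) \<partial>PiM J M)"
    using assms by (intro product_nn_integral_prod[symmetric]) auto
  also have "\<dots> = (\<integral>\<^sup>+z. (\<Prod>i\<in>J. f i (z i)) \<partial>distr (PiM I M) (PiM J M) (\<lambda>x. restrict x J))"
    by (simp add: distr_PiM_restrict_finite[OF assms(1,2)])
  also have "\<dots> = (\<integral>\<^sup>+z. (\<Prod>i\<in>J. f i (restrict z J i)) \<partial>PiM I M)"
    using assms(2) by (intro nn_integral_distr measurable_restrict_subset) auto
  finally show ?thesis by (simp cong: prod.cong)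
qed

text \<open>Completing the square in the exponent, followed by translation invariance of Lebesgue
  measure.\<close>

lemma nn_integral_normal_shift:
  assumes [measurable]: "h \<in> borel_measurable borel" and "\<sigma> > 0"
  shows "(\<integral>\<^sup>+t. h (a + t) \<partial>density lborel (normal_density 0 \<sigma>))
    = (\<integral>\<^sup>+t. ennreal (exp (a * t / \<sigma>\<^sup>2 - a\<^sup>2 / (2 * \<sigma>\<^sup>2))) * h t \<partial>density lborel (normal_density 0 \<sigma>))"
proof -
  have *: "normal_density 0 \<sigma> t * exp (a * t / \<sigma>\<^sup>2 - a\<^sup>2 / (2 * \<sigma>\<^sup>2)) = normal_density 0 \<sigma> (t - a)" for t
  proof -
    have "- t\<^sup>2 / (2 * \<sigma>\<^sup>2) + (a * t / \<sigma>\<^sup>2 - a\<^sup>2 / (2 * \<sigma>\<^sup>2)) = - (t - a)\<^sup>2 / (2 * \<sigma>\<^sup>2)"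
      using \<open>\<sigma> > 0\<close> by (simp add: field_simps power2_eq_square)
    then show ?thesis
      unfolding normal_density_def by (simp only: mult.assoc exp_add[symmetric] diff_zero)
  qed
  have "(\<integral>\<^sup>+t. ennreal (exp (a * t / \<sigma>\<^sup>2 - a\<^sup>2 / (2 * \<sigma>\<^sup>2))) * h t \<partial>density lborel (normal_density 0 \<sigma>))
      = (\<integral>\<^sup>+t. ennreal (normal_density 0 \<sigma> t) * (ennreal (exp (a * t / \<sigma>\<^sup>2 - a\<^sup>2 / (2 * \<sigma>\<^sup>2))) * h t) \<partial>lborel)"
    by (rule nn_integral_density) measurable
  also have "\<dots> = (\<integral>\<^sup>+t. ennreal (normal_density 0 \<sigma> (t - a)) * h t \<partial>lborel)"
    by (simp only: mult.assoc[symmetric] ennreal_mult'[symmetric] normal_density_nonneg *)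
  also have "\<dots> = (\<integral>\<^sup>+t. ennreal (normal_density 0 \<sigma> t) * h (a + t) \<partial>lborel)"
    by (subst nn_integral_real_affine[where c=1 and t=a]) auto
  also have "\<dots> = (\<integral>\<^sup>+t. h (a + t) \<partial>density lborel (normal_density 0 \<sigma>))"
    by (rule nn_integral_density[symmetric]) measurable
  finally show ?thesis by simp
qed

text \<open>The Cameron-Martin density of the noise shifted by \<open>a\<close>, for
  \<open>a\<close> supported on the first \<open>N\<close> coordinates. The divisors are the
  variance \<open>N0 / 2\<close> and twice the variance.\<close>

definition girsanov :: "real \<Rightarrow> nat \<Rightarrow> (nat \<Rightarrow> real) \<Rightarrow> (nat \<Rightarrow> real) \<Rightarrow> real" where
  "girsanov N0 N a z = exp ((\<Sum>i<N. a i * z i) / (N0 / 2) - (\<Sum>i<N. (a i)\<^sup>2) / N0)"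

lemma sets_noise: "sets (noise N0) = sets (PiM UNIV (\<lambda>_. borel))"
  unfolding noise_def by (intro sets_PiM_cong) auto

lemma measurable_girsanov [measurable]: "girsanov N0 N a \<in> borel_measurable (noise N0)"
proof -
  have "girsanov N0 N a \<in> borel_measurable (PiM UNIV (\<lambda>_. borel))"
    unfolding girsanov_def by measurable
  then show ?thesis using measurable_cong_sets[OF sets_noise refl] by blast
qed

lemma measurable_noise_shift: "(\<lambda>z n. a n + z n) \<in> measurable (noise N0) (noise N0)"
proof -
  have "(\<lambda>z n. a n + z n) \<in> measurable (PiM UNIV (\<lambda>_. borel)) (PiM UNIV (\<lambda>_. borel :: real measure))"
    by (rule measurable_PiM_single') auto
  then show ?thesis using measurable_cong_sets[OF sets_noise sets_noise] by blast
qed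

text \<open>Both measures are compared on cylinder sets, where the claim splits into the
  one-dimensional shift formula for each coordinate.\<close>

lemma noise_shift_density:
  assumes N0: "N0 > 0" and a: "\<And>n. n \<ge> N \<Longrightarrow> a n = 0"
  shows "distr (noise N0) (noise N0) (\<lambda>z n. a n + z n) = density (noise N0) (\<lambda>z. ennreal (girsanov N0 N a z))"
proof -
  define \<sigma> where "\<sigma> = sqrt (N0 / 2)"
  have \<sigma>: "\<sigma> > 0" "\<sigma>\<^sup>2 = N0 / 2" using N0 by (simp_all add: \<sigma>_def)
  let ?G = "density lborel (\<lambda>x. ennreal (normal_density 0 \<sigma> x))"
  interpret product_prob_space "\<lambda>_::nat. ?G" UNIV
    by (intro product_prob_spaceI prob_space_normal_density \<sigma>)
  have noise: "noise N0 = PiM UNIV (\<lambda>_. ?G)" by (simp add: noise_def \<sigma>_def)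
  note shift_meas = measurable_noise_shift[of a N0]
  have L_meas: "(\<lambda>z. ennreal (girsanov N0 N a z)) \<in> borel_measurable (noise N0)" by measurable
  define r where "r i t = exp (a i * t / \<sigma>\<^sup>2 - (a i)\<^sup>2 / (2 * \<sigma>\<^sup>2))" for i t
  show ?thesis
  proof (rule measure_eqI_PiM_infinite[where I=UNIV and M="\<lambda>_. ?G"])
    show "finite_measure (distr (noise N0) (noise N0) (\<lambda>z n. a n + z n))"
      using prob_space_distr[OF shift_meas[unfolded noise]] by (simp add: noise prob_space_def)
  next
    fix A :: "nat \<Rightarrow> real set" and J :: "nat set"
    assume J: "finite J" and "\<And>i. i \<in> J \<Longrightarrow> A i \<in> sets ?G"
    then have A: "A i \<in> sets borel" if "i \<in> J" for i using that by simp
    let ?E = "prod_emb UNIV (\<lambda>_. ?G) J (Pi\<^sub>E J A)"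
    have E: "?E = {z. \<forall>i\<in>J. z i \<in> A i}"
      by (auto simp: prod_emb_def space_PiM Pi_iff)
    have E_sets: "?E \<in> sets (noise N0)"
      unfolding noise using J A by (intro sets_PiM_I) auto
    define h :: "nat \<Rightarrow> real \<Rightarrow> ennreal" where "h i = (if i \<in> J then indicator (A i) else (\<lambda>_. 1))" for i
    have h_meas [measurable]: "h i \<in> borel_measurable borel" for i using A by (auto simp: h_def)
    \<comment> \<open>Adding the coordinates in which the shift may act turns the cylinder indicator
      and the density into products over one finite index set. The surplus factors are 1 on either
      side.\<close>
    define J' where "J' = J \<union> {..<N}"
    have J': "finite J'" using J by (simp add: J'_def)
    have ind: "indicator ?E z = (\<Prod>i\<in>J'. h i (z i))" for z
    proof (cases "z \<in> ?E")
      case True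
      then have "h i (z i) = 1" for i by (auto simp: E h_def)
      with True show ?thesis by simp
    next
      case False
      then obtain i where "i \<in> J" "z i \<notin> A i" by (auto simp: E)
      then have "h i (z i) = 0" "i \<in> J'" by (auto simp: h_def J'_def)
      then have "(\<Prod>i\<in>J'. h i (z i)) = 0" using J' by (meson prod_zero)
      with False show ?thesis by simp
    qed
    have L: "ennreal (girsanov N0 N a z) = (\<Prod>i\<in>J'. ennreal (r i (z i)))" for z
    proof -
      have "(\<Sum>i<N. a i * z i) / (N0 / 2) - (\<Sum>i<N. (a i)\<^sup>2) / N0
          = (\<Sum>i<N. a i * z i / \<sigma>\<^sup>2 - (a i)\<^sup>2 / (2 * \<sigma>\<^sup>2))"
        unfolding \<sigma> sum_subtractf sum_divide_distrib by simp
      also have "\<dots> = (\<Sum>i\<in>J'. a i * z i / \<sigma>\<^sup>2 - (a i)\<^sup>2 / (2 * \<sigma>\<^sup>2))"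
        using J' a by (intro sum.mono_neutral_left) (auto simp: J'_def)
      finally show ?thesis using J' by (simp add: girsanov_def r_def exp_sum prod_ennreal)
    qed
    have "emeasure (distr (noise N0) (noise N0) (\<lambda>z n. a n + z n)) ?E
        = (\<integral>\<^sup>+z. indicator ?E z \<partial>distr (noise N0) (noise N0) (\<lambda>z n. a n + z n))"
      using E_sets by simp
    also have "\<dots> = (\<integral>\<^sup>+z. indicator ?E (\<lambda>n. a n + z n) \<partial>noise N0)"
      using E_sets by (intro nn_integral_distr shift_meas) auto
    also have "\<dots> = (\<integral>\<^sup>+z. (\<Prod>i\<in>J'. h i (a i + z i)) \<partial>noise N0)"
      by (simp only: ind)
    also have "\<dots> = (\<Prod>i\<in>J'. \<integral>\<^sup>+t. h i (a i + t) \<partial>?G)"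
      unfolding noise using J' by (intro nn_integral_PiM_prod) auto
    also have "\<dots> = (\<Prod>i\<in>J'. \<integral>\<^sup>+t. ennreal (r i t) * h i t \<partial>?G)"
      unfolding r_def by (intro prod.cong refl nn_integral_normal_shift \<sigma>) measurable
    also have "\<dots> = (\<integral>\<^sup>+z. (\<Prod>i\<in>J'. ennreal (r i (z i)) * h i (z i)) \<partial>noise N0)"
      unfolding noise using J' by (intro nn_integral_PiM_prod[symmetric]) (auto simp: r_def)
    also have "\<dots> = (\<integral>\<^sup>+z. ennreal (girsanov N0 N a z) * indicator ?E z \<partial>noise N0)"
      by (simp only: ind L prod.distrib)
    also have "\<dots> = emeasure (density (noise N0) (\<lambda>z. ennreal (girsanov N0 N a z))) ?E"
      by (rule emeasure_density[OF L_meas E_sets, symmetric])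
    finally show "emeasure (distr (noise N0) (noise N0) (\<lambda>z n. a n + z n)) ?E
        = emeasure (density (noise N0) (\<lambda>z. ennreal (girsanov N0 N a z))) ?E" .
  qed (auto simp: noise)
qed

lemma nn_integral_noise_shift:
  assumes "N0 > 0" "\<And>n. n \<ge> N \<Longrightarrow> a n = 0" and f: "f \<in> borel_measurable (noise N0)"
  shows "(\<integral>\<^sup>+z. f (\<lambda>n. a n + z n) \<partial>noise N0) = (\<integral>\<^sup>+z. ennreal (girsanov N0 N a z) * f z \<partial>noise N0)"
proof -
  have "(\<integral>\<^sup>+z. f (\<lambda>n. a n + z n) \<partial>noise N0) = (\<integral>\<^sup>+z. f z \<partial>distr (noise N0) (noise N0) (\<lambda>z n. a n + z n))"
    using f by (subst nn_integral_distr[OF measurable_noise_shift]) auto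
  also have "\<dots> = (\<integral>\<^sup>+z. ennreal (girsanov N0 N a z) * f z \<partial>noise N0)"
  proof -
    have "distr (noise N0) (noise N0) (\<lambda>z n. a n + z n) = density (noise N0) (\<lambda>z. ennreal (girsanov N0 N a z))"
      using assms(1,2) by (rule noise_shift_density)
    then show ?thesis using f by (simp add: nn_integral_density)
  qed
  finally show ?thesis .
qed

lemma prob_space_noise: "N0 > 0 \<Longrightarrow> prob_space (noise N0)"
  unfolding noise_def by (intro prob_space_PiM prob_space_normal_density) auto

text \<open>Two-point argument: \<open>u = 0\<close> and \<open>u = 1/2\<close> are both recentred at the midpoint of their signals,
  and the two likelihood ratios have product \<open>exp (- 2 D / N0)\<close>, so by AM-GM their minimum cannot be
  small on average.\<close>
lemma mpae_lower_bound:
  assumes sys: "valid_system P W T s g" and pos: "\<alpha> > 0" "N0 > 0" "T > 0"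
  shows "mpae \<alpha> N0 s g \<ge> ennreal ((1 / 4) powr \<alpha> * exp (- 2 * P * T / N0) / 4)"
proof -
  from sys have "\<exists>N::nat. (\<forall>u n. N \<le> n \<longrightarrow> s u n = 0) \<and> (\<forall>u\<in>{0..<1}. 1 / T * (\<Sum>n<N. (s u n)\<^sup>2) \<le> P)"
    and g: "g \<in> borel_measurable (PiM UNIV (\<lambda>_. borel))"
    unfolding valid_system_def by blast+
  then obtain N where N: "\<And>u n. N \<le> n \<Longrightarrow> s u n = 0"
      "\<And>u. u \<in> {0..<1} \<Longrightarrow> 1 / T * (\<Sum>n<N. (s u n)\<^sup>2) \<le> P"
    by blast
  have g_meas: "g \<in> borel_measurable (noise N0)"
    using g measurable_cong_sets[OF sets_noise refl] by blast
  interpret prob_space "noise N0" by (rule prob_space_noise) fact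
  define q where "q n = (s 0 n + s (1 / 2) n) / 2" for n
  define d where "d n = (s (1 / 2) n - s 0 n) / 2" for n
  define D where "D = (\<Sum>i<N. (d i)\<^sup>2)"
  have "D \<le> (\<Sum>i<N. ((s 0 i)\<^sup>2 + (s (1 / 2) i)\<^sup>2) / 2)"
    unfolding D_def d_def
  proof (rule sum_mono)
    fix i
    have "0 \<le> (s 0 i + s (1 / 2) i)\<^sup>2" by simp
    then show "((s (1 / 2) i - s 0 i) / 2)\<^sup>2 \<le> ((s 0 i)\<^sup>2 + (s (1 / 2) i)\<^sup>2) / 2"
      by (simp add: power2_eq_square field_simps)
  qed
  also have "\<dots> = ((\<Sum>i<N. (s 0 i)\<^sup>2) + (\<Sum>i<N. (s (1 / 2) i)\<^sup>2)) / 2"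
    by (simp add: sum.distrib sum_divide_distrib[symmetric])
  also have "\<dots> \<le> P * T"
    using N(2)[of 0] N(2)[of "1 / 2"] pos by (simp add: field_simps)
  finally have D: "D \<le> P * T" .
  define E where "E = exp (- (2 * D / N0))"
  define Lp where "Lp = girsanov N0 N d"
  define Lm where "Lm = girsanov N0 N (\<lambda>n. - d n)"
  have [measurable]: "Lp \<in> borel_measurable (noise N0)" "Lm \<in> borel_measurable (noise N0)"
    unfolding Lp_def Lm_def by measurable
  have Lpos: "Lp z > 0" "Lm z > 0" for z by (simp_all add: Lp_def Lm_def girsanov_def)
  have prod: "Lp z * Lm z = E" for z
    using pos by (simp add: Lp_def Lm_def girsanov_def E_def D_def sum_negf flip: exp_add)
  have d0: "d n = 0" if "n \<ge> N" for n using N(1)[OF that] by (simp add: d_def)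
  have Lint: "(\<integral>\<^sup>+z. ennreal (Lp z) \<partial>noise N0) = 1" "(\<integral>\<^sup>+z. ennreal (Lm z) \<partial>noise N0) = 1"
    using nn_integral_noise_shift[OF \<open>N0 > 0\<close>, of N d "\<lambda>_. 1"] d0
      nn_integral_noise_shift[OF \<open>N0 > 0\<close>, of N "\<lambda>n. - d n" "\<lambda>_. 1"]
    by (simp_all add: Lp_def Lm_def emeasure_space_1)
  define mn where "mn z = min (Lp z) (Lm z)" for z
  have [measurable]: "mn \<in> borel_measurable (noise N0)" unfolding mn_def by measurable
  have "E > 0" by (simp add: E_def)
  \<comment> \<open>With \<open>x\<close> the smaller and \<open>y\<close> the larger ratio,
    \<open>x * (y / 2 - 1)\<^sup>2 \<ge> 0\<close> and \<open>x * y = E\<close> give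
    \<open>E \<le> x + E / 4 * y\<close>. Both ratios integrate to 1, so the symmetric form leaves
    half of \<open>E\<close> for the integral of the minimum.\<close>
  have amgm: "E \<le> mn z + (E / 4 * Lp z + E / 4 * Lm z)" for z
  proof -
    have *: "E \<le> x + (E / 4 * x + E / 4 * y)" if "x > 0" "y > 0" "x * y = E" for x y
    proof -
      have "0 \<le> x * (y / 2 - 1)\<^sup>2" using that by simp
      also have "\<dots> = x * y / 4 * y - x * y + x"
        by (simp add: power2_eq_square field_simps)
      finally have "E \<le> x + E / 4 * y" using that by simp
      moreover have "E / 4 * x > 0" using that \<open>E > 0\<close> by simp
      ultimately show ?thesis by linarith
    qed
    show ?thesis
      using *[of "Lp z" "Lm z"] *[of "Lm z" "Lp z"] Lpos[of z] prod[of z]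
      by (auto simp: mn_def min_def mult.commute)
  qed
  have "ennreal E = (\<integral>\<^sup>+z. ennreal E \<partial>noise N0)" by (simp add: emeasure_space_1)
  also have "\<dots> \<le> (\<integral>\<^sup>+z. ennreal (mn z) + (ennreal (E / 4) * ennreal (Lp z) + ennreal (E / 4) * ennreal (Lm z)) \<partial>noise N0)"
  proof (rule nn_integral_mono)
    fix z
    have "mn z \<ge> 0" using Lpos[of z] by (simp add: mn_def)
    then show "ennreal E \<le> ennreal (mn z) + (ennreal (E / 4) * ennreal (Lp z) + ennreal (E / 4) * ennreal (Lm z))"
      using amgm[of z] Lpos[of z] \<open>E > 0\<close>
      by (simp add: ennreal_mult[symmetric] ennreal_plus[symmetric] ennreal_leI del: ennreal_plus)
  qed
  also have "\<dots> = (\<integral>\<^sup>+z. ennreal (mn z) \<partial>noise N0) + (ennreal (E / 4) + ennreal (E / 4))"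
    by (simp add: nn_integral_add nn_integral_cmult Lint)
  also have "ennreal (E / 4) + ennreal (E / 4) = ennreal (E / 2)"
    using \<open>E > 0\<close> by (subst ennreal_plus[symmetric]) auto
  finally have mn: "ennreal (E / 2) \<le> (\<integral>\<^sup>+z. ennreal (mn z) \<partial>noise N0)"
  proof -
    assume "ennreal E \<le> (\<integral>\<^sup>+z. ennreal (mn z) \<partial>noise N0) + ennreal (E / 2)"
    also have "\<dots> = ennreal (E / 2) + (\<integral>\<^sup>+z. ennreal (mn z) \<partial>noise N0)" by (rule add.commute)
    also have "ennreal E = ennreal (E / 2) + ennreal (E / 2)"
      using \<open>E > 0\<close> by (subst ennreal_plus[symmetric]) auto
    finally show ?thesis using ennreal_add_left_cancel_le[of "ennreal (E / 2)"] by simp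
  qed
  define f0 where "f0 z = ennreal (\<bar>g (\<lambda>n. q n + z n) - 0\<bar> powr \<alpha>)" for z
  define f1 where "f1 z = ennreal (\<bar>g (\<lambda>n. q n + z n) - 1 / 2\<bar> powr \<alpha>)" for z
  have [measurable]: "(\<lambda>z. g (\<lambda>n. q n + z n)) \<in> borel_measurable (noise N0)"
    by (rule measurable_compose[OF measurable_noise_shift g_meas])
  have [measurable]: "f0 \<in> borel_measurable (noise N0)" "f1 \<in> borel_measurable (noise N0)"
    unfolding f0_def f1_def by measurable
  \<comment> \<open>The parameters 0 and 1/2 are 1/2 apart, so any estimate misses one of them by at
    least 1/4, and the weight of that one is at least the minimum.\<close>
  have sep: "ennreal ((1 / 4) powr \<alpha>) * ennreal (mn z) \<le> ennreal (Lm z) * f0 z + ennreal (Lp z) * f1 z" for z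
  proof -
    define t where "t = g (\<lambda>n. q n + z n)"
    have "\<bar>t - 0\<bar> \<ge> 1 / 4 \<or> \<bar>t - 1 / 2\<bar> \<ge> 1 / 4" by arith
    then have "ennreal ((1 / 4) powr \<alpha>) \<le> f0 z \<or> ennreal ((1 / 4) powr \<alpha>) \<le> f1 z"
      unfolding f0_def f1_def t_def[symmetric] using pos by (auto intro!: ennreal_leI powr_mono2)
    then show ?thesis
    proof
      assume "ennreal ((1 / 4) powr \<alpha>) \<le> f0 z"
      then have "ennreal ((1 / 4) powr \<alpha>) * ennreal (mn z) \<le> f0 z * ennreal (Lm z)"
        by (intro mult_mono ennreal_leI) (auto simp: mn_def)
      then show ?thesis by (simp add: mult.commute add_increasing2)
    next
      assume "ennreal ((1 / 4) powr \<alpha>) \<le> f1 z"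
      then have "ennreal ((1 / 4) powr \<alpha>) * ennreal (mn z) \<le> f1 z * ennreal (Lp z)"
        by (intro mult_mono ennreal_leI) (auto simp: mn_def)
      then show ?thesis by (simp add: mult.commute add_increasing)
    qed
  qed
  have "ennreal ((1 / 4) powr \<alpha> * E / 2) = ennreal ((1 / 4) powr \<alpha>) * ennreal (E / 2)"
    by (simp flip: ennreal_mult')
  also have "\<dots> \<le> ennreal ((1 / 4) powr \<alpha>) * (\<integral>\<^sup>+z. ennreal (mn z) \<partial>noise N0)"
    by (intro mult_left_mono mn) auto
  also have "\<dots> = (\<integral>\<^sup>+z. ennreal ((1 / 4) powr \<alpha>) * ennreal (mn z) \<partial>noise N0)"
    by (rule nn_integral_cmult[symmetric]) measurable
  also have "\<dots> \<le> (\<integral>\<^sup>+z. ennreal (Lm z) * f0 z + ennreal (Lp z) * f1 z \<partial>noise N0)"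
    by (intro nn_integral_mono sep)
  also have "\<dots> = (\<integral>\<^sup>+z. ennreal (Lm z) * f0 z \<partial>noise N0) + (\<integral>\<^sup>+z. ennreal (Lp z) * f1 z \<partial>noise N0)"
    by (rule nn_integral_add) measurable
  also have "\<dots> = (\<integral>\<^sup>+z. f0 (\<lambda>n. - d n + z n) \<partial>noise N0) + (\<integral>\<^sup>+z. f1 (\<lambda>n. d n + z n) \<partial>noise N0)"
    unfolding Lm_def Lp_def using d0
    by (intro arg_cong2[where f="(+)"] nn_integral_noise_shift[symmetric] \<open>N0 > 0\<close>) (auto, measurable)
  also have "\<dots> = (\<integral>\<^sup>+ z. ennreal (\<bar>g (\<lambda>n. s 0 n + z n) - 0\<bar> powr \<alpha>) \<partial>noise N0)
      + (\<integral>\<^sup>+ z. ennreal (\<bar>g (\<lambda>n. s (1 / 2) n + z n) - 1 / 2\<bar> powr \<alpha>) \<partial>noise N0)"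
  proof -
    have "q n + (- d n + z) = s 0 n + z" "q n + (d n + z) = s (1 / 2) n + z" for n z
      by (simp_all add: q_def d_def field_simps)
    then show ?thesis by (simp only: f0_def f1_def)
  qed
  also have "\<dots> \<le> mpae \<alpha> N0 s g + mpae \<alpha> N0 s g"
    unfolding mpae_def by (intro add_mono SUP_upper) auto
  finally have two: "ennreal ((1 / 4) powr \<alpha> * E / 2) \<le> mpae \<alpha> N0 s g + mpae \<alpha> N0 s g" .
  have "ennreal ((1 / 4) powr \<alpha> * E / 4) \<le> mpae \<alpha> N0 s g"
  proof (rule ccontr)
    assume "\<not> ?thesis"
    then have "mpae \<alpha> N0 s g + mpae \<alpha> N0 s g < ennreal ((1 / 4) powr \<alpha> * E / 4) + ennreal ((1 / 4) powr \<alpha> * E / 4)"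
      by (intro add_strict_mono) auto
    also have "\<dots> = ennreal ((1 / 4) powr \<alpha> * E / 2)"
      using \<open>E > 0\<close> by (subst ennreal_plus[symmetric]) auto
    finally show False using two by simp
  qed
  moreover have "(1 / 4) powr \<alpha> * exp (- 2 * P * T / N0) / 4 \<le> (1 / 4) powr \<alpha> * E / 4"
    using D pos by (auto simp: E_def divide_right_mono)
  ultimately show ?thesis by (meson ennreal_leI order_trans)
qed

section \<open>Comparison of exponents\<close>

lemma err_exp_time_scale:
  assumes "k > 0"
  shows "err_exp T e = ereal k * err_exp (k * T) e"
  using assms by (auto simp: err_exp_def)

lemma err_exp_ennreal: "b > 0 \<Longrightarrow> err_exp T (ennreal b) = ereal (- ln b / T)"
  by (simp add: err_exp_def)

lemma err_exp_antimono:
  assumes "T > 0" "e \<le> e'"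
  shows "err_exp T e' \<le> err_exp T e"
proof (cases "e' = \<infinity> \<or> e = 0")
  case True
  then show ?thesis by (auto simp: err_exp_def top_unique)
next
  case False
  then obtain b where b: "e' = ennreal b" "b \<ge> 0" by (cases e') auto
  with assms False obtain a where a: "e = ennreal a" "a \<ge> 0" by (cases e) (auto simp: top_unique)
  from a b False assms have "a > 0" "a \<le> b" by (auto simp: less_le)
  with a b assms show ?thesis by (simp add: err_exp_ennreal divide_right_mono)
qed

lemma err_exp_cmult:
  assumes "b > 0"
  shows "err_exp T (ennreal b * e) = err_exp T e + ereal (- ln b / T)"
proof (cases "e = \<infinity> \<or> e = 0")
  case True
  then show ?thesis using assms by (auto simp: err_exp_def ennreal_mult_top)
next
  case False
  then obtain a where a: "e = ennreal a" "a \<ge> 0" by (cases e) auto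
  with False have "a > 0" by (auto simp: less_le)
  with a assms show ?thesis
    by (simp add: err_exp_ennreal ennreal_mult'[symmetric] ln_mult_pos diff_divide_distrib add.commute)
qed

text \<open>For duration \<open>T\<close> the system of duration \<open>k * T\<close> with
  \<open>k = x / \<Gamma>\<close> is used. Its energy is at most
  \<open>\<Gamma> * k * T = x * T\<close> and its dimension fits because \<open>k \<le> 1\<close>.
  The same error measured against the longer duration has its exponent multiplied by
  \<open>k\<close>.\<close>

lemma achievable_smaller_power:
  assumes ach: "achievable \<alpha> \<Gamma> N0 W E" and x: "0 < x" "x \<le> \<Gamma>" and W: "W \<ge> 0"
  shows "achievable \<alpha> x N0 W (x / \<Gamma> * E)"
proof -
  define k where "k = x / \<Gamma>"
  have k: "0 < k" "k \<le> 1" "k * \<Gamma> = x" using x by (auto simp: k_def)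
  from ach obtain sys where valid: "\<And>T. T > 0 \<Longrightarrow> valid_system \<Gamma> W T (fst (sys T)) (snd (sys T))"
    and E: "ereal E \<le> Limsup at_top (\<lambda>T. err_exp T (mpae \<alpha> N0 (fst (sys T)) (snd (sys T))))"
    unfolding achievable_def by blast
  define h where "h T = err_exp T (mpae \<alpha> N0 (fst (sys T)) (snd (sys T)))" for T
  have "valid_system x W T (fst (sys (k * T))) (snd (sys (k * T)))" if "T > 0" for T
  proof -
    have kT: "k * T > 0" using k that by simp
    from valid[OF kT] obtain N :: nat where N: "real N \<le> 2 * W * (k * T)"
        "\<forall>u n. N \<le> n \<longrightarrow> fst (sys (k * T)) u n = 0"
        "\<forall>u\<in>{0..<1}. 1 / (k * T) * (\<Sum>n<N. (fst (sys (k * T)) u n)\<^sup>2) \<le> \<Gamma>"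
      and meas: "\<forall>n. (\<lambda>u. fst (sys (k * T)) u n) \<in> borel_measurable borel"
        "snd (sys (k * T)) \<in> borel_measurable (PiM UNIV (\<lambda>_. borel))"
      unfolding valid_system_def by blast
    have "W * (k * T) \<le> W * T" using W k that by (intro mult_left_mono) (auto simp: mult_le_cancel_right1)
    then have "real N \<le> 2 * W * T" using N(1) by linarith
    moreover have "1 / T * (\<Sum>n<N. (fst (sys (k * T)) u n)\<^sup>2) \<le> x" if "u \<in> {0..<1}" for u
    proof -
      have "(\<Sum>n<N. (fst (sys (k * T)) u n)\<^sup>2) \<le> \<Gamma> * (k * T)"
        using N(3)[rule_format, OF that] kT by (simp add: divide_le_eq)
      also have "\<dots> = x * T" by (simp add: k(3)[symmetric])
      finally show ?thesis using \<open>T > 0\<close> by (simp add: divide_le_eq)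
    qed
    ultimately show ?thesis unfolding valid_system_def using N(2) meas by blast
  qed
  moreover have "ereal (k * E) \<le> Limsup at_top (\<lambda>T. err_exp T (mpae \<alpha> N0 (fst (sys (k * T))) (snd (sys (k * T)))))"
  proof -
    have "ereal (k * E) = ereal k * ereal E" by simp
    also have "\<dots> \<le> ereal k * Limsup at_top h"
      using E k unfolding h_def by (intro ereal_mult_left_mono) auto
    \<comment> \<open>A positive rescaling of time is a bijection preserving \<open>at_top\<close>,
      so it does not change the limit superior.\<close>
    also have "Limsup at_top h = Limsup (filtermap ((*) k) at_top) h"
    proof -
      have "filtermap ((*) k) at_top = at_top"
      proof (rule filtermap_fun_inverse)
        show "filterlim ((*) (inverse k)) at_top at_top" "filterlim ((*) k) at_top at_top"
          using k by (auto intro!: filterlim_tendsto_pos_mult_at_top[OF tendsto_const _ filterlim_ident])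
        show "\<forall>\<^sub>F y in at_top. k * (inverse k * y) = y" using k by simp
      qed
      then show ?thesis by simp
    qed
    also have "\<dots> = Limsup at_top (\<lambda>T. h (k * T))"
      using k by (intro Limsup_filtermap_eq) (auto simp: inj_def)
    also have "ereal k * \<dots> = Limsup at_top (\<lambda>T. ereal k * h (k * T))"
      using k by (intro Limsup_ereal_mult_left[symmetric]) auto
    also have "(\<lambda>T. ereal k * h (k * T)) = (\<lambda>T. err_exp T (mpae \<alpha> N0 (fst (sys (k * T))) (snd (sys (k * T)))))"
      unfolding h_def by (intro ext err_exp_time_scale[OF k(1), symmetric])
    finally show ?thesis .
  qed
  ultimately show ?thesis
    unfolding achievable_def k_def by (intro exI[of _ "\<lambda>T. sys (x / \<Gamma> * T)"]) auto
qed

text \<open>The factor lost by \<open>shrink_system\<close> is \<open>K powr \<alpha>\<close> times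
  an exponential in \<open>T\<close>. The exponential gives the logarithmic loss in the exponent,
  and the constant contributes at most \<epsilon> once \<open>T\<close> is large.\<close>

lemma achievable_shrink:
  assumes ach: "achievable \<alpha> \<Gamma> N0 1 E" and pos: "\<alpha> > 0" "\<Gamma> > 0" and c: "0 < c" "c \<le> 1"
    and \<epsilon>: "\<epsilon> > 0"
  shows "achievable \<alpha> (c\<^sup>2 * \<Gamma>) N0 1 (E - 2 * \<alpha> * ln (sqrt (1 + \<epsilon>) / c) - \<epsilon>)"
proof -
  from ach obtain sys where valid: "\<And>T. T > 0 \<Longrightarrow> valid_system \<Gamma> 1 T (fst (sys T)) (snd (sys T))"
    and E: "ereal E \<le> Limsup at_top (\<lambda>T. err_exp T (mpae \<alpha> N0 (fst (sys T)) (snd (sys T))))"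
    unfolding achievable_def by blast
  define K where "K = 4 * sqrt (2 * pi) * exp (1 / 2 + 1 / (2 * \<epsilon>))"
  define q where "q = sqrt (1 + \<epsilon>) / c"
  define B where "B T = (K * q powr (2 * T)) powr \<alpha>" for T
  have K: "K > 0" by (simp add: K_def)
  have q: "q > 0" using c \<epsilon> by (simp add: q_def)
  have B: "B T > 0" for T using K q by (simp add: B_def)
  have lnB: "ln (B T) = \<alpha> * ln K + 2 * \<alpha> * T * ln q" for T
    using K q by (simp add: B_def ln_powr ln_mult_pos algebra_simps)
  have "\<exists>p. valid_system (c\<^sup>2 * \<Gamma>) 1 T (fst p) (snd p) \<and>
      mpae \<alpha> N0 (fst p) (snd p) \<le> ennreal (B T) * mpae \<alpha> N0 (fst (sys T)) (snd (sys T))" if T: "T > 0" for T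
  proof -
    obtain s' g' where "valid_system (c\<^sup>2 * \<Gamma>) 1 T s' g'"
      "mpae \<alpha> N0 s' g' \<le> ennreal (B T) * mpae \<alpha> N0 (fst (sys T)) (snd (sys T))"
      using shrink_system[OF valid[OF T] pos T c \<epsilon>] unfolding B_def K_def q_def by metis
    then show ?thesis by (intro exI[of _ "(s', g')"]) simp
  qed
  then obtain sys' where sys': "\<And>T. T > 0 \<Longrightarrow> valid_system (c\<^sup>2 * \<Gamma>) 1 T (fst (sys' T)) (snd (sys' T))"
    "\<And>T. T > 0 \<Longrightarrow> mpae \<alpha> N0 (fst (sys' T)) (snd (sys' T)) \<le> ennreal (B T) * mpae \<alpha> N0 (fst (sys T)) (snd (sys T))"
    by metis
  define r where "r = - 2 * \<alpha> * ln q - \<epsilon>"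
  have "ereal (E + r) = ereal E + ereal r" by simp
  also have "\<dots> \<le> Limsup at_top (\<lambda>T. err_exp T (mpae \<alpha> N0 (fst (sys T)) (snd (sys T)))) + ereal r"
    using E by (rule add_right_mono)
  also have "\<dots> = Limsup at_top (\<lambda>T. err_exp T (mpae \<alpha> N0 (fst (sys T)) (snd (sys T))) + ereal r)"
    by (rule Limsup_add_ereal_right[symmetric]) auto
  also have "\<dots> \<le> Limsup at_top (\<lambda>T. err_exp T (mpae \<alpha> N0 (fst (sys' T)) (snd (sys' T))))"
  proof (rule Limsup_mono)
    show "\<forall>\<^sub>F T in at_top. err_exp T (mpae \<alpha> N0 (fst (sys T)) (snd (sys T))) + ereal r
        \<le> err_exp T (mpae \<alpha> N0 (fst (sys' T)) (snd (sys' T)))"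
      using eventually_gt_at_top[of 0] eventually_ge_at_top[of "\<alpha> * ln K / \<epsilon>"]
    proof eventually_elim
      fix T :: real assume T: "0 < T" "\<alpha> * ln K / \<epsilon> \<le> T"
      have "ln (B T) / T = \<alpha> * ln K / T + 2 * \<alpha> * ln q"
        using T by (simp add: lnB add_divide_distrib)
      moreover have "\<alpha> * ln K / T \<le> \<epsilon>" using T \<epsilon> by (simp add: field_simps)
      ultimately have "r \<le> - ln (B T) / T" by (simp add: r_def)
      then have "err_exp T (mpae \<alpha> N0 (fst (sys T)) (snd (sys T))) + ereal r
          \<le> err_exp T (mpae \<alpha> N0 (fst (sys T)) (snd (sys T))) + ereal (- ln (B T) / T)"
        by (intro add_left_mono) simp
      also have "\<dots> = err_exp T (ennreal (B T) * mpae \<alpha> N0 (fst (sys T)) (snd (sys T)))"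
        by (rule err_exp_cmult[OF B, symmetric])
      also have "\<dots> \<le> err_exp T (mpae \<alpha> N0 (fst (sys' T)) (snd (sys' T)))"
        by (rule err_exp_antimono[OF T(1) sys'(2)[OF T(1)]])
      finally show "err_exp T (mpae \<alpha> N0 (fst (sys T)) (snd (sys T))) + ereal r
        \<le> err_exp T (mpae \<alpha> N0 (fst (sys' T)) (snd (sys' T)))" .
    qed
  qed
  finally have "ereal (E + r) \<le> Limsup at_top (\<lambda>T. err_exp T (mpae \<alpha> N0 (fst (sys' T)) (snd (sys' T))))" .
  then have "achievable \<alpha> (c\<^sup>2 * \<Gamma>) N0 1 (E + r)"
    unfolding achievable_def using sys'(1) by blast
  moreover have "E + r = E - 2 * \<alpha> * ln (sqrt (1 + \<epsilon>) / c) - \<epsilon>" by (simp add: r_def q_def)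
  ultimately show ?thesis by (simp only:)
qed

text \<open>A crude bound whose purpose is that the supremum in \<open>opt_exp\<close> ranges over a
  set bounded above.\<close>

lemma achievable_le:
  assumes ach: "achievable \<alpha> \<Gamma> N0 W E" and pos: "\<alpha> > 0" "N0 > 0"
  shows "E \<le> 2 * \<Gamma> / N0 + (\<alpha> + 1) * ln 4"
proof -
  from ach obtain sys where valid: "\<And>T. T > 0 \<Longrightarrow> valid_system \<Gamma> W T (fst (sys T)) (snd (sys T))"
    and E: "ereal E \<le> Limsup at_top (\<lambda>T. err_exp T (mpae \<alpha> N0 (fst (sys T)) (snd (sys T))))"
    unfolding achievable_def by blast
  have "Limsup at_top (\<lambda>T. err_exp T (mpae \<alpha> N0 (fst (sys T)) (snd (sys T))))
      \<le> ereal (2 * \<Gamma> / N0 + (\<alpha> + 1) * ln 4)"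
  proof (rule Limsup_bounded)
    show "\<forall>\<^sub>F T in at_top. err_exp T (mpae \<alpha> N0 (fst (sys T)) (snd (sys T)))
        \<le> ereal (2 * \<Gamma> / N0 + (\<alpha> + 1) * ln 4)"
      using eventually_ge_at_top[of 1]
    proof eventually_elim
      fix T :: real assume "1 \<le> T"
      then have T: "T > 0" by simp
      let ?b = "(1 / 4) powr \<alpha> * exp (- 2 * \<Gamma> * T / N0) / 4"
      have "err_exp T (mpae \<alpha> N0 (fst (sys T)) (snd (sys T))) \<le> err_exp T (ennreal ?b)"
        by (rule err_exp_antimono[OF T mpae_lower_bound[OF valid[OF T] pos T]])
      also have "\<dots> = ereal (- ln ?b / T)" by (rule err_exp_ennreal) simp
      also have "- ln ?b / T = 2 * \<Gamma> / N0 + (\<alpha> + 1) * ln 4 / T"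
      proof -
        have "ln ?b = - (\<alpha> + 1) * ln 4 - 2 * \<Gamma> * T / N0"
          by (simp add: ln_mult_pos ln_div ln_powr algebra_simps)
        then show ?thesis using T pos by (simp add: field_simps)
      qed
      also have "ereal \<dots> \<le> ereal (2 * \<Gamma> / N0 + (\<alpha> + 1) * ln 4)"
      proof -
        \<comment> \<open>This term vanishes as \<open>T\<close> grows; its value at
          \<open>T = 1\<close> is good enough for boundedness.\<close>
        have "(\<alpha> + 1) * ln 4 / T \<le> (\<alpha> + 1) * ln 4 / 1"
          using \<open>1 \<le> T\<close> pos by (intro divide_left_mono) auto
        then show ?thesis by simp
      qed
      finally show "err_exp T (mpae \<alpha> N0 (fst (sys T)) (snd (sys T)))
        \<le> ereal (2 * \<Gamma> / N0 + (\<alpha> + 1) * ln 4)" .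
    qed
  qed
  with E have "ereal E \<le> ereal (2 * \<Gamma> / N0 + (\<alpha> + 1) * ln 4)" by (rule order_trans)
  then show ?thesis by simp
qed

text \<open>Silence together with the constant estimate 0 has error at most 1. This makes the set of
  achievable exponents nonempty and \<open>F_exp\<close> nonnegative.\<close>

lemma achievable_zero:
  assumes "\<alpha> > 0" "\<Gamma> \<ge> 0" "N0 > 0" "W \<ge> 0"
  shows "achievable \<alpha> \<Gamma> N0 W 0"
proof -
  let ?s = "\<lambda>(u::real) (n::nat). 0 :: real" and ?g = "\<lambda>y::nat \<Rightarrow> real. 0 :: real"
  interpret prob_space "noise N0" by (rule prob_space_noise) fact
  have "mpae \<alpha> N0 ?s ?g \<le> 1"
    unfolding mpae_def
  proof (rule SUP_least)
    fix u :: real assume u: "u \<in> {0..<1}"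
    then have "\<bar>u\<bar> powr \<alpha> \<le> 1 powr \<alpha>" using assms by (intro powr_mono2) auto
    then have "(\<integral>\<^sup>+ z. ennreal (\<bar>0 - u\<bar> powr \<alpha>) \<partial>noise N0) \<le> (\<integral>\<^sup>+ z. 1 \<partial>noise N0)"
      by (intro nn_integral_mono) (simp add: ennreal_le_1)
    then show "(\<integral>\<^sup>+ z. ennreal (\<bar>0 - u\<bar> powr \<alpha>) \<partial>noise N0) \<le> 1" by (simp add: emeasure_space_1)
  qed
  then have "ereal 0 \<le> err_exp T (mpae \<alpha> N0 ?s ?g)" if "T > 0" for T
    using err_exp_antimono[OF that, of "mpae \<alpha> N0 ?s ?g" 1] err_exp_ennreal[of 1 T] by simp
  then have "ereal 0 \<le> Limsup at_top (\<lambda>T. err_exp T (mpae \<alpha> N0 ?s ?g))"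
    by (intro le_Limsup eventually_mono[OF eventually_gt_at_top[of 0]]) auto
  moreover have "valid_system \<Gamma> W T ?s ?g" if "T > 0" for T
    using assms that by (auto simp: valid_system_def intro!: exI[of _ 0])
  ultimately show ?thesis
    unfolding achievable_def by (intro exI[of _ "\<lambda>_. (?s, ?g)"]) auto
qed

section \<open>From achievable exponents to their supremum \<open>F_exp\<close>\<close>

lemma achievable_bdd_above:
  assumes "\<alpha> > 0"
  shows "bdd_above {E. achievable \<alpha> \<Gamma> 1 1 E}"
  using achievable_le[of \<alpha> \<Gamma> 1 1] assms by (intro bdd_aboveI) auto

lemma achievable_le_F_exp: "\<alpha> > 0 \<Longrightarrow> achievable \<alpha> \<Gamma> 1 1 E \<Longrightarrow> E \<le> F_exp \<alpha> \<Gamma>"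
  unfolding F_exp_def opt_exp_def by (intro cSup_upper achievable_bdd_above) auto

lemma F_exp_least:
  assumes "\<alpha> > 0" "\<Gamma> \<ge> 0" "\<And>E. achievable \<alpha> \<Gamma> 1 1 E \<Longrightarrow> E \<le> b"
  shows "F_exp \<alpha> \<Gamma> \<le> b"
  unfolding F_exp_def opt_exp_def
proof (rule cSup_least)
  show "{E. achievable \<alpha> \<Gamma> 1 1 E} \<noteq> {}" using achievable_zero[of \<alpha> \<Gamma> 1 1] assms by auto
qed (use assms in auto)

lemma F_exp_div_antimono:
  assumes "\<alpha> > 0" "0 < x" "x \<le> \<Gamma>"
  shows "F_exp \<alpha> \<Gamma> / \<Gamma> \<le> F_exp \<alpha> x / x"
proof -
  have "F_exp \<alpha> \<Gamma> \<le> \<Gamma> / x * F_exp \<alpha> x"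
  proof (rule F_exp_least)
    fix E assume "achievable \<alpha> \<Gamma> 1 1 E"
    then have "x / \<Gamma> * E \<le> F_exp \<alpha> x"
      using assms by (intro achievable_le_F_exp achievable_smaller_power) auto
    then show "E \<le> \<Gamma> / x * F_exp \<alpha> x" using assms by (simp add: field_simps)
  qed (use assms in auto)
  then show ?thesis using assms by (simp add: field_simps)
qed

text \<open>The amplitude ratio is \<open>c = sqrt (x / \<Gamma>)\<close>, hence
  \<open>- 2 * \<alpha> * ln c = \<alpha> * ln (\<Gamma> / x)\<close>. The losses in \<epsilon> are
  removed by a limit at the level of the supremum, where a fixed inequality between reals
  survives.\<close>

lemma F_exp_minus_log_antimono:
  assumes "\<alpha> > 0" "0 < x" "x \<le> \<Gamma>"
  shows "F_exp \<alpha> \<Gamma> \<le> F_exp \<alpha> x + \<alpha> * ln (\<Gamma> / x)"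
proof -
  define c where "c = sqrt (x / \<Gamma>)"
  have c: "0 < c" "c \<le> 1" "c\<^sup>2 * \<Gamma> = x" using assms by (auto simp: c_def)
  have bound: "F_exp \<alpha> \<Gamma> \<le> F_exp \<alpha> x + 2 * \<alpha> * ln (sqrt (1 + \<epsilon>) / c) + \<epsilon>" if "\<epsilon> > 0" for \<epsilon>
  proof (rule F_exp_least)
    fix E assume "achievable \<alpha> \<Gamma> 1 1 E"
    then have "E - 2 * \<alpha> * ln (sqrt (1 + \<epsilon>) / c) - \<epsilon> \<le> F_exp \<alpha> x"
      using achievable_shrink[of \<alpha> \<Gamma> 1 E c \<epsilon>] assms c that by (intro achievable_le_F_exp) auto
    then show "E \<le> F_exp \<alpha> x + 2 * \<alpha> * ln (sqrt (1 + \<epsilon>) / c) + \<epsilon>" by simp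
  qed (use assms in auto)
  have "((\<lambda>\<epsilon>. F_exp \<alpha> x + 2 * \<alpha> * ln (sqrt (1 + \<epsilon>) / c) + \<epsilon>) \<longlongrightarrow>
      F_exp \<alpha> x + 2 * \<alpha> * ln (sqrt (1 + 0) / c) + 0) (at_right 0)"
    using c by (intro tendsto_intros) auto
  moreover have "\<forall>\<^sub>F \<epsilon> in at_right 0. F_exp \<alpha> \<Gamma> \<le> F_exp \<alpha> x + 2 * \<alpha> * ln (sqrt (1 + \<epsilon>) / c) + \<epsilon>"
    using bound by (auto simp: eventually_at_filter)
  ultimately have "F_exp \<alpha> \<Gamma> \<le> F_exp \<alpha> x + 2 * \<alpha> * ln (sqrt (1 + 0) / c) + 0"
    by (rule tendsto_lowerbound) simp
  moreover have "2 * ln (sqrt (1 + 0) / c) = ln (\<Gamma> / x)"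
    using assms by (simp add: c_def ln_div ln_sqrt real_sqrt_divide)
  ultimately show ?thesis by (simp add: mult.assoc mult.left_commute[of 2])
qed

theorem mainTheorem2:
  fixes \<alpha> \<Gamma> \<gamma> :: real
  assumes "\<alpha> > 0" and "\<Gamma> > 0"
    and "((\<lambda>x. F_exp \<alpha> x / x) \<longlongrightarrow> \<gamma>) (at_right 0)"
  shows "F_exp \<alpha> \<Gamma> \<le> (if \<Gamma> < \<alpha> / \<gamma> then \<gamma> * \<Gamma> else \<alpha> * (ln (\<gamma> * \<Gamma> / \<alpha>) + 1))"
proof -
  have linear: "F_exp \<alpha> x \<le> \<gamma> * x" if "x > 0" for x
  proof -
    \<comment> \<open>The ratio is antitone, so its limit at zero from the right bounds it
      everywhere.\<close>
    have "\<forall>\<^sub>F y in at_right 0. F_exp \<alpha> x / x \<le> F_exp \<alpha> y / y"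
      using that by (auto simp: eventually_at_right[OF that] intro!: exI[of _ x] F_exp_div_antimono assms)
    from tendsto_lowerbound[OF assms(3) this] have "F_exp \<alpha> x / x \<le> \<gamma>" by simp
    then show ?thesis using that by (simp add: field_simps)
  qed
  have "0 \<le> F_exp \<alpha> \<Gamma>"
    using assms by (intro achievable_le_F_exp achievable_zero) auto
  also have "\<dots> \<le> \<gamma> * \<Gamma>" by (rule linear) fact
  finally have "\<gamma> \<ge> 0" using \<open>\<Gamma> > 0\<close> by (simp add: zero_le_mult_iff)
  show ?thesis
  \<comment> \<open>For \<open>\<gamma> = 0\<close> the conventions \<open>\<alpha> / 0 = 0\<close>
    and \<open>ln 0 = 0\<close> select the second branch with value \<alpha>, and the linear bound
    already gives \<open>F_exp \<alpha> \<Gamma> \<le> 0\<close>.\<close>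
  proof (cases "\<gamma> = 0 \<or> \<Gamma> < \<alpha> / \<gamma>")
    case True
    then show ?thesis using linear[OF \<open>\<Gamma> > 0\<close>] assms by auto
  next
    case False
    \<comment> \<open>This \<open>x\<close> minimises
      \<open>\<gamma> * x + \<alpha> * ln (\<Gamma> / x)\<close> over positive \<open>x\<close>, and
      it is admissible, that is at most \<Gamma>, exactly in the logarithmic case.\<close>
    define x where "x = \<alpha> / \<gamma>"
    have x: "0 < x" "x \<le> \<Gamma>" using False \<open>\<gamma> \<ge> 0\<close> assms by (auto simp: x_def)
    have "F_exp \<alpha> \<Gamma> \<le> F_exp \<alpha> x + \<alpha> * ln (\<Gamma> / x)"
      using assms x by (intro F_exp_minus_log_antimono)
    also have "F_exp \<alpha> x \<le> \<gamma> * x" using x by (intro linear)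
    also have "\<gamma> * x + \<alpha> * ln (\<Gamma> / x) = \<alpha> * (ln (\<gamma> * \<Gamma> / \<alpha>) + 1)"
      using False by (simp add: x_def algebra_simps)
    finally show ?thesis using False by simp
  qed
qed

end
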